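(* Let $L\colon A\to\mathbb{R}$ be a linear functional with $L(1)=1$ that is $\sum A^2$-positive. The following are equivalent: (i) There exists a unique representing Radon measure $\nu_L$ for $L$ with compact support. (ii) $\sup_{n\in\mathbb{N}}\sqrt[2n]{L(a^{2n})}<\infty$ for all $a\in A$. (iii) $L$ is $p$-continuous for some submultiplicative seminorm $p$ on $A$. (iv) $L$ is $Q$-positive for some Archimedean quadratic module $Q$ in $A$. In this case, the submultiplicative seminorm $p_L$ defined by $p_L(a):=\sup_{n\in\mathbb{N}}\sqrt[2n]{L(a^{2n})}$ for all $a\in A$ is the smallest submultiplicative seminorm on $A$ with respect to which $L$ is continuous, and the Archimedean quadratic module $Q_L:=\{a\in A: L(b^2a)\ge 0\text{ for all }b\in A\}$, which is generated by the elements $\sup_{n\in\mathbb{N}}\sqrt[2n]{L(a^{2n})}\pm a$ with $a\in A$, is the largest Archimedean quadratic module in $A$ on which $L$ is positive. Moreover, $p_L=\|\cdot\|_{\operatorname{supp}(\nu_L)}$ and $Q_L=\operatorname{Pos}(\operatorname{supp}(\nu_L))$, as well as $$\operatorname{supp}(\nu_L)=K_L=\mathfrak{sp}(p_L)=\mathcal{S}(Q_L),$$ where $K_L:=\{\alpha\in X(A): |\alpha(a)|\le \sup_{n\in\mathbb{N}}\sqrt[2n]{L(a^{2n})}\text{ for all }a\in A\}$.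
   Context: $A$ is a unital commutative $\mathbb{R}$-algebra whose character space $X(A)$ (the set of all (unital) $\mathbb{R}$-algebra homomorphisms $A\to\mathbb{R}$) is non-empty; $X(A)$ carries the weakest topology making all $\hat a\colon X(A)\to\mathbb{R}$, $\hat a(\alpha)=\alpha(a)$, $a\in A$, continuous. $\mathbb{N}=\{1,2,\dots\}$. Measures: a Radon measure on $X(A)$ is a non-negative Borel measure that is locally finite and inner regular w.r.t. compact sets; $\operatorname{supp}(\nu)$ is the smallest closed $C\subseteq X(A)$ with $\nu(X(A)\setminus C)=0$; a representing Radon measure for $L$ is a Radon measure $\nu$ on $X(A)$ with $L(a)=\int \hat a\,\mathrm{d}\nu$ for all $a\in A$. Quadratic modules: $Q\subseteq A$ is a quadratic module if $1\in Q$, $Q+Q\subseteq Q$ and $a^2q\in Q$ for all $a\in A$, $q\in Q$; it is Archimedean if for each $a\in A$ there is $N\in\mathbb{N}$ with $N\pm a\in Q$. The quadratic module generated by a set is the smallest one containing it. $\sum A^2$ is the quadratic module of finite sums of squares. $L$ is $Q$-positive (positive on $Q$) if $L(Q)\subseteq[0,\infty)$. $\mathcal{S}(Q):=\{\alpha\in X(A): \hat a(\alpha)\ge0\text{ for all }a\in Q\}$. For closed $C\subseteq X(A)$, $\operatorname{Pos}(C):=\{a\in A:\hat a(\alpha)\ge 0\text{ for all }\alpha\in C\}$. Seminorms: a seminorm on $A$ is $p\colon A\to[0,\infty)$ with $p(\lambda a)=|\lambda|p(a)$ and $p(a+b)\le p(a)+p(b)$; it is submultiplicative if $p(ab)\le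 p(a)p(b)$. A linear functional $\ell\colon A\to\mathbb{R}$ is $p$-continuous if there is $C>0$ with $|\ell(a)|\le C\,p(a)$ for all $a\in A$. $\mathfrak{sp}(p):=\{\alpha\in X(A):\alpha\text{ is }p\text{-continuous}\}$. For compact $K\subseteq X(A)$, $\|a\|_K:=\max_{\alpha\in K}|\alpha(a)|$. Seminorms are ordered pointwise, quadratic modules by inclusion. *)

theory Defs
  imports "HOL-Analysis.Analysis"
begin

text \<open>The unital commutative real algebra \<open>A\<close> is a type \<open>'a\<close> of sort
  \<open>{real_algebra_1, comm_ring_1}\<close>. A character is a function \<open>'a \<Rightarrow> real\<close>, so that
  the Gelfand transform of \<open>a\<close> is \<open>\<lambda>\<alpha>. \<alpha> a\<close>.\<close>

section \<open>The character space\<close>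

definition character_space :: "('a::{real_algebra_1, comm_ring_1} \<Rightarrow> real) set" where
  "character_space =
    {\<alpha>. linear \<alpha> \<and> \<alpha> 1 = 1 \<and> (\<forall>a b. \<alpha> (a * b) = \<alpha> a * \<alpha> b)}"

definition character_topology :: "('a::{real_algebra_1, comm_ring_1} \<Rightarrow> real) topology" where
  "character_topology =
    topology_generated_by {{\<alpha> \<in> character_space. \<alpha> a \<in> U} | a U. open U}"

section \<open>Radon measures\<close>

text \<open>The compact sets below need to be Borel, which is automatic in Hausdorff spaces such as the
  character space.\<close>

definition radon_measure :: "'b topology \<Rightarrow> 'b measure \<Rightarrow> bool" where
  "radon_measure X \<nu> \<longleftrightarrow>
    space \<nu> = topspace X \<and>
    sets \<nu> = sigma_sets (topspace X) {U. openin X U} \<and>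
    (\<forall>x\<in>topspace X. \<exists>U. openin X U \<and> x \<in> U \<and> emeasure \<nu> U < \<infinity>) \<and>
    (\<forall>B\<in>sets \<nu>. emeasure \<nu> B = (SUP K\<in>{K. compactin X K \<and> K \<subseteq> B}. emeasure \<nu> K))"

definition measure_support :: "'b topology \<Rightarrow> 'b measure \<Rightarrow> 'b set" where
  "measure_support X \<nu> = (LEAST C. closedin X C \<and> emeasure \<nu> (topspace X - C) = 0)"

text \<open>Integrability is required explicitly because the Bochner integral of a non-integrable function
  is \<open>0\<close>.\<close>

definition representing_radon_measure ::
    "('a::{real_algebra_1, comm_ring_1} \<Rightarrow> real) \<Rightarrow> ('a \<Rightarrow> real) measure \<Rightarrow> bool" where
  "representing_radon_measure L \<nu> \<longleftrightarrow>
    radon_measure character_topology \<nu> \<and>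
    (\<forall>a. integrable \<nu> (\<lambda>\<alpha>. \<alpha> a) \<and> L a = (\<integral>\<alpha>. \<alpha> a \<partial>\<nu>))"

section \<open>Quadratic modules\<close>

definition quadratic_module :: "'a::{real_algebra_1, comm_ring_1} set \<Rightarrow> bool" where
  "quadratic_module Q \<longleftrightarrow>
    1 \<in> Q \<and> (\<forall>q\<in>Q. \<forall>r\<in>Q. q + r \<in> Q) \<and> (\<forall>a. \<forall>q\<in>Q. a\<^sup>2 * q \<in> Q)"

definition archimedean_quadratic_module :: "'a::{real_algebra_1, comm_ring_1} set \<Rightarrow> bool" where
  "archimedean_quadratic_module Q \<longleftrightarrow>
    quadratic_module Q \<and> (\<forall>a. \<exists>N::nat. 1 \<le> N \<and> of_nat N + a \<in> Q \<and> of_nat N - a \<in> Q)"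

definition sums_of_squares :: "'a::{real_algebra_1, comm_ring_1} set" where
  "sums_of_squares = {\<Sum>x\<leftarrow>xs. x\<^sup>2 | xs. True}"

definition positive_on :: "('a \<Rightarrow> real) \<Rightarrow> 'a set \<Rightarrow> bool" where
  "positive_on L Q \<longleftrightarrow> (\<forall>q\<in>Q. 0 \<le> L q)"

definition nonneg_characters ::
    "'a::{real_algebra_1, comm_ring_1} set \<Rightarrow> ('a \<Rightarrow> real) set" where
  "nonneg_characters Q = {\<alpha> \<in> character_space. \<forall>a\<in>Q. 0 \<le> \<alpha> a}"

definition Pos :: "('a::{real_algebra_1, comm_ring_1} \<Rightarrow> real) set \<Rightarrow> 'a set" where
  "Pos C = {a. \<forall>\<alpha>\<in>C. 0 \<le> \<alpha> a}"

section \<open>Seminorms\<close>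

definition submultiplicative_seminorm ::
    "('a::{real_algebra_1, comm_ring_1} \<Rightarrow> real) \<Rightarrow> bool" where
  "submultiplicative_seminorm p \<longleftrightarrow>
    (\<forall>a. 0 \<le> p a) \<and>
    (\<forall>c a. p (c *\<^sub>R a) = \<bar>c\<bar> * p a) \<and>
    (\<forall>a b. p (a + b) \<le> p a + p b) \<and>
    (\<forall>a b. p (a * b) \<le> p a * p b)"

definition seminorm_continuous :: "('a \<Rightarrow> real) \<Rightarrow> ('a \<Rightarrow> real) \<Rightarrow> bool" where
  "seminorm_continuous p l \<longleftrightarrow> (\<exists>C>0. \<forall>a. \<bar>l a\<bar> \<le> C * p a)"

definition gelfand_spectrum ::
    "('a::{real_algebra_1, comm_ring_1} \<Rightarrow> real) \<Rightarrow> ('a \<Rightarrow> real) set" where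
  "gelfand_spectrum p = {\<alpha> \<in> character_space. seminorm_continuous p \<alpha>}"

definition max_seminorm :: "('a \<Rightarrow> real) set \<Rightarrow> 'a \<Rightarrow> real" where
  "max_seminorm K a = (GREATEST x. x \<in> (\<lambda>\<alpha>. \<bar>\<alpha> a\<bar>) ` K)"

section \<open>Objects attached to a functional\<close>

text \<open>The supremum of the \<open>2n\<close>-th roots of the even moments, taken in the extended reals since it may
  be infinite.\<close>

definition moment_growth :: "('a::{real_algebra_1, comm_ring_1} \<Rightarrow> real) \<Rightarrow> 'a \<Rightarrow> ereal" where
  "moment_growth L a = (SUP n\<in>{1..}. ereal (root (2 * n) (L (a ^ (2 * n)))))"

text \<open>Only meaningful when \<open>moment_growth L\<close> is finite; \<open>real_of_ereal\<close> maps \<open>\<infinity>\<close> to \<open>0\<close>.\<close>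

definition moment_seminorm :: "('a::{real_algebra_1, comm_ring_1} \<Rightarrow> real) \<Rightarrow> 'a \<Rightarrow> real" where
  "moment_seminorm L a = real_of_ereal (moment_growth L a)"

definition moment_quadratic_module ::
    "('a::{real_algebra_1, comm_ring_1} \<Rightarrow> real) \<Rightarrow> 'a set" where
  "moment_quadratic_module L = {a. \<forall>b. 0 \<le> L (b\<^sup>2 * a)}"

definition moment_characters ::
    "('a::{real_algebra_1, comm_ring_1} \<Rightarrow> real) \<Rightarrow> ('a \<Rightarrow> real) set" where
  "moment_characters L =
    {\<alpha> \<in> character_space. \<forall>a. ereal \<bar>\<alpha> a\<bar> \<le> moment_growth L a}"

end

theory Submission
  imports Defs
begin

text \<open>An Archimedean quadratic module without \<open>-1\<close> lies in a maximal one, \<open>M\<close>. Then \<open>M \<union> -M\<close> is the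
  whole algebra, and \<open>a \<mapsto> sup {r. a - r \<in> M}\<close> is a character, nonnegative on \<open>M\<close>.
  Let \<open>p\<close> be the moment seminorm and \<open>Q\<close> the moment quadratic module of \<open>L\<close>, and suppose that \<open>p\<close>
  is finite. Iterating the Cauchy--Schwarz inequality gives
  \<open>\<bar>L (b\<^sup>2 a)\<bar> \<le> L (b\<^sup>2) p a\<close>, so \<open>p a \<plusminus> a \<in> Q\<close> and \<open>Q\<close> is Archimedean. For \<open>r < p a\<close>, adjoining
  \<open>a\<^sup>2 - r\<^sup>2\<close> to \<open>Q\<close> does not produce \<open>-1\<close>, as otherwise the even moments of \<open>a\<close> would grow like
  powers of \<open>r\<close>; hence some character nonnegative on \<open>Q\<close> satisfies \<open>\<bar>\<alpha> a\<bar> \<ge> r\<close>. Therefore \<open>p\<close> is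
  the supremum norm over the compact set \<open>K\<close> of these characters, from which the properties of \<open>p\<close>
  and \<open>Q\<close> can be read off. In particular \<open>L\<close> extends to a positive functional on the continuous
  functions on \<open>K\<close>, and the Riesz--Markov theorem yields the representing measure. Conversely, the
  support of a compactly supported representing measure is recovered from the growth of moments and
  the Stone--Weierstrass theorem.\<close>

section \<open>The Riesz--Markov theorem on a compact Hausdorff space\<close>

text \<open>The classes have to be instantiated one by one, since the arity
  \<open>fun :: (countable, metric_space) metric_space\<close> of the library would otherwise be in conflict.\<close>

instance "fun" :: (type, t0_space) t0_space
proof
  fix f g :: "'a \<Rightarrow> 'b" assume "f \<noteq> g"
  then obtain x where "f x \<noteq> g x" by auto
  then obtain U where U: "open U" "\<not> (f x \<in> U \<longleftrightarrow> g x \<in> U)"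
    using separation_t0[of "f x" "g x"] by auto
  have "open ((\<lambda>h::'a \<Rightarrow> 'b. h x) -` U)"
    using U by (auto intro!: open_vimage continuous_on_product_coordinates)
  then show "\<exists>U. open U \<and> \<not> (f \<in> U \<longleftrightarrow> g \<in> U)"
    using U by (metis vimage_eq)
qed

instance "fun" :: (type, t1_space) t1_space
proof
  fix f g :: "'a \<Rightarrow> 'b" assume "f \<noteq> g"
  then obtain x where "f x \<noteq> g x" by auto
  then obtain U where U: "open U" "f x \<in> U" "g x \<notin> U"
    by (meson t1_space)
  have "open ((\<lambda>h::'a \<Rightarrow> 'b. h x) -` U)"
    using U by (auto intro!: open_vimage continuous_on_product_coordinates)
  then show "\<exists>U. open U \<and> f \<in> U \<and> g \<notin> U"
    using U by (metis vimage_eq)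
qed

instance "fun" :: (type, t2_space) t2_space
proof
  fix f g :: "'a \<Rightarrow> 'b" assume "f \<noteq> g"
  then obtain x where "f x \<noteq> g x" by auto
  then obtain U V where UV: "open U" "open V" "f x \<in> U" "g x \<in> V" "U \<inter> V = {}"
    by (meson hausdorff)
  have "open ((\<lambda>h::'a \<Rightarrow> 'b. h x) -` U)" "open ((\<lambda>h::'a \<Rightarrow> 'b. h x) -` V)"
    using UV by (auto intro!: open_vimage continuous_on_product_coordinates)
  then show "\<exists>U V. open U \<and> open V \<and> f \<in> U \<and> g \<in> V \<and> U \<inter> V = {}"
    using UV by (intro exI[of _ "(\<lambda>h. h x) -` U"] exI[of _ "(\<lambda>h. h x) -` V"]) auto
qed

text \<open>A compact Hausdorff subspace is normal, so Urysohn's lemma applies to the traces of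
  \<open>S\<close> and \<open>T\<close> on \<open>K\<close>. Disjointness is asked for inside
  \<open>K\<close> only, since the functionals below see functions only there.\<close>

lemma Urysohn_compact:
  fixes K :: "'b::t2_space set"
  assumes "compact K" "closed S" "closed T" "K \<inter> S \<inter> T = {}"
  shows "\<exists>h :: 'b \<Rightarrow> real. continuous_on K h \<and> (\<forall>x\<in>K. 0 \<le> h x \<and> h x \<le> 1) \<and>
    (\<forall>x\<in>K \<inter> S. h x = 0) \<and> (\<forall>x\<in>K \<inter> T. h x = 1)"
proof -
  have "Hausdorff_space (euclidean :: 'b topology)"
    unfolding Hausdorff_space_def disjnt_def using hausdorff by (metis open_openin)
  then have n: "normal_space (top_of_set K)"
    using assms(1) by (intro compact_Hausdorff_or_regular_imp_normal_space)
      (simp_all add: compact_space_subtopology Hausdorff_space_subtopology)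
  have c: "closedin (top_of_set K) (K \<inter> S)" "closedin (top_of_set K) (K \<inter> T)"
    using assms by (auto simp: closedin_closed_Int)
  have d: "disjnt (K \<inter> S) (K \<inter> T)"
    using assms by (auto simp: disjnt_def)
  obtain h where h: "continuous_map (top_of_set K) (top_of_set {0..1::real}) h"
    "h ` (K \<inter> S) \<subseteq> {0}" "h ` (K \<inter> T) \<subseteq> {1}"
    using Urysohn_lemma[OF n c d, of 0 1] by auto
  then show ?thesis
    by (intro exI[of _ h]) (auto simp: continuous_map_in_subtopology image_subset_iff)
qed

text \<open>A positive functional on C(\<open>K\<close>), whose elements are encoded as total
  functions that are continuous on \<open>K\<close>. As \<open>mono\<close> compares values on
  \<open>K\<close> only, it also makes \<open>\<Lambda>\<close> independent of the values elsewhere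
  (\<open>cong\<close>).\<close>

locale positive_functional =
  fixes K :: "'b::t2_space set" and \<Lambda> :: "('b \<Rightarrow> real) \<Rightarrow> real"
  assumes compact: "compact K"
    and add: "continuous_on K f \<Longrightarrow> continuous_on K g \<Longrightarrow> \<Lambda> (\<lambda>x. f x + g x) = \<Lambda> f + \<Lambda> g"
    and scale: "continuous_on K f \<Longrightarrow> \<Lambda> (\<lambda>x. c * f x) = c * \<Lambda> f"
    and mono: "continuous_on K f \<Longrightarrow> continuous_on K g \<Longrightarrow> (\<And>x. x \<in> K \<Longrightarrow> f x \<le> g x) \<Longrightarrow> \<Lambda> f \<le> \<Lambda> g"
begin

lemma zero: "\<Lambda> (\<lambda>x. 0) = 0"
  using scale[of "\<lambda>x. 0" 0] by simp

lemma const: "\<Lambda> (\<lambda>x. c) = c * \<Lambda> (\<lambda>x. 1)"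
  using scale[of "\<lambda>x. 1" c] by simp

lemma nonneg: "continuous_on K f \<Longrightarrow> (\<And>x. x \<in> K \<Longrightarrow> 0 \<le> f x) \<Longrightarrow> 0 \<le> \<Lambda> f"
  using mono[of "\<lambda>x. 0" f] zero by simp

lemma sum:
  assumes "finite I" "\<And>i. i \<in> I \<Longrightarrow> continuous_on K (f i)"
  shows "\<Lambda> (\<lambda>x. \<Sum>i\<in>I. f i x) = (\<Sum>i\<in>I. \<Lambda> (f i))"
  using assms
proof (induction I rule: finite_induct)
  case (insert i I)
  then show ?case
    by (simp add: add continuous_on_sum)
qed (simp add: zero)

lemma cong: "continuous_on K f \<Longrightarrow> (\<And>x. x \<in> K \<Longrightarrow> f x = g x) \<Longrightarrow> \<Lambda> f = \<Lambda> g"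
  using mono[of f g] mono[of g f] continuous_on_cong[of K K f g] by force

section \<open>Contents of open sets and the outer measure they induce\<close>

definition subordinate :: "'b set \<Rightarrow> ('b \<Rightarrow> real) set" where
  "subordinate U = {f. continuous_on K f \<and> (\<forall>x\<in>K. 0 \<le> f x \<and> f x \<le> indicator U x)}"

definition open_content :: "'b set \<Rightarrow> ennreal" where
  "open_content U = (SUP f\<in>subordinate U. ennreal (\<Lambda> f))"

definition outer_content :: "'b set \<Rightarrow> ennreal" where
  "outer_content E = (INF U\<in>{U. open U \<and> E \<subseteq> U}. open_content U)"

lemma open_content_ge: "f \<in> subordinate U \<Longrightarrow> ennreal (\<Lambda> f) \<le> open_content U"
  by (auto simp: open_content_def intro: SUP_upper)

lemma subordinateI:
  "\<lbrakk>continuous_on K f; \<And>x. x \<in> K \<Longrightarrow> 0 \<le> f x; \<And>x. x \<in> K \<Longrightarrow> f x \<le> 1; \<And>x. x \<in> K \<Longrightarrow> x \<notin> U \<Longrightarrow> f x \<le> 0\<rbrakk>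
    \<Longrightarrow> f \<in> subordinate U"
  by (auto simp: subordinate_def indicator_def)

lemma zero_subordinate: "(\<lambda>x. 0) \<in> subordinate U"
  by (simp add: subordinate_def)

lemma subordinateD:
  assumes "f \<in> subordinate U"
  shows "continuous_on K f" "\<And>x. x \<in> K \<Longrightarrow> 0 \<le> f x" "\<And>x. x \<in> K \<Longrightarrow> f x \<le> 1"
    "\<And>x. x \<in> K \<Longrightarrow> x \<notin> U \<Longrightarrow> f x = 0" "0 \<le> \<Lambda> f"
proof -
  show 1: "continuous_on K f" "\<And>x. x \<in> K \<Longrightarrow> 0 \<le> f x" "\<And>x. x \<in> K \<Longrightarrow> x \<notin> U \<Longrightarrow> f x = 0"
    using assms by (force simp: subordinate_def)+
  show "f x \<le> 1" if "x \<in> K" for x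
    using assms that by (auto simp: subordinate_def indicator_def intro: order_trans split: if_splits)
  show "0 \<le> \<Lambda> f" using 1 nonneg by blast
qed

lemma subordinate_mono:
  assumes "K \<inter> U \<subseteq> V" shows "subordinate U \<subseteq> subordinate V"
proof
  fix f assume "f \<in> subordinate U"
  note f = subordinateD[OF this]
  then show "f \<in> subordinate V"
    using assms by (intro subordinateI) fastforce+
qed

lemma open_content_mono: "K \<inter> U \<subseteq> V \<Longrightarrow> open_content U \<le> open_content V"
  unfolding open_content_def by (intro SUP_subset_mono subordinate_mono) auto

lemma outer_content_open: "open U \<Longrightarrow> outer_content U = open_content U"
  unfolding outer_content_def
  by (intro antisym INF_lower INF_greatest open_content_mono) auto

lemma outer_content_mono: "E \<subseteq> F \<Longrightarrow> outer_content E \<le> outer_content F"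
  unfolding outer_content_def by (intro INF_superset_mono) auto

lemma open_content_null: "K \<inter> U = {} \<Longrightarrow> open_content U = 0"
proof -
  assume U: "K \<inter> U = {}"
  have "ennreal (\<Lambda> f) = 0" if "f \<in> subordinate U" for f
    using cong[of f "\<lambda>x. 0"] subordinateD[OF that] U zero by (force simp: ennreal_eq_0_iff)
  then show "open_content U = 0"
    unfolding open_content_def by (simp add: SUP_eq_iff bot_ennreal[symmetric] SUP_bot_conv)
qed

lemma open_content_UNIV: "open_content UNIV = ennreal (\<Lambda> (\<lambda>x. 1))"
proof (rule antisym)
  show "open_content UNIV \<le> ennreal (\<Lambda> (\<lambda>x. 1))"
    unfolding open_content_def
    by (intro SUP_least ennreal_leI mono) (auto dest: subordinateD)
  show "ennreal (\<Lambda> (\<lambda>x. 1)) \<le> open_content UNIV"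
    by (intro open_content_ge subordinateI) auto
qed

text \<open>A function in \<open>subordinate U\<close> vanishes off \<open>U\<close>, but its
  support may reach the boundary. Lowering it by \<open>d\<close> and truncating at 0 leaves a
  function that lives on the compact set where \<open>f\<close> is at least \<open>d\<close>, at a
  cost of at most \<open>d\<close> times the total mass \<open>m\<close>.\<close>

lemma cutoff:
  assumes f: "f \<in> subordinate U" and e: "0 < e"
  obtains g C where "continuous_on K g" "compact C" "C \<subseteq> K \<inter> U" "\<And>x. x \<in> K \<Longrightarrow> 0 \<le> g x"
    "\<And>x. x \<in> K \<Longrightarrow> g x \<le> 1" "\<And>x. x \<in> K \<Longrightarrow> x \<notin> C \<Longrightarrow> g x = 0" "\<Lambda> f \<le> \<Lambda> g + e"
proof -
  note fD = subordinateD[OF f]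
  define m where "m = \<Lambda> (\<lambda>x. 1)"
  have m: "0 \<le> m" unfolding m_def by (rule nonneg) auto
  \<comment> \<open>What matters is \<open>0 < d\<close> and \<open>d * m \<le> e\<close>; the
    summand 1 allows for \<open>m = 0\<close>.\<close>
  define d where "d = e / (m + 1)"
  have d: "0 < d" "d * m \<le> e" using e m by (auto simp: d_def field_simps)
  define g where "g = (\<lambda>x. max (f x - d) 0)"
  have cg: "continuous_on K g" unfolding g_def by (intro continuous_intros fD)
  define C where "C = K \<inter> f -` {d..}"
  have "closed C" unfolding C_def
    using fD compact by (intro continuous_closed_preimage) (auto intro: compact_imp_closed)
  then have C: "compact C"
    using compact compact_Int_closed[of K C] by (simp add: C_def Int_absorb1)
  have "\<Lambda> f \<le> \<Lambda> (\<lambda>x. g x + d)"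
    by (intro mono continuous_intros cg fD) (auto simp: g_def)
  also have "\<dots> = \<Lambda> g + d * m"
    using add[of g "\<lambda>x. d"] cg by (simp add: const[of d] m_def)
  finally have "\<Lambda> f \<le> \<Lambda> g + e" using d by simp
  moreover have "C \<subseteq> K \<inter> U" using fD(4) d by (fastforce simp: C_def)
  moreover have "g x \<le> 1" if "x \<in> K" for x using fD(3)[OF that] d by (simp add: g_def)
  ultimately show thesis
    using cg C by (intro that[of g C]) (auto simp: g_def C_def)
qed

text \<open>A partition of unity: \<open>h\<close> vanishes on \<open>C - U\<close> and equals 1 on
  \<open>C - V\<close>, so \<open>g\<close> splits into \<open>h * g\<close>, which vanishes off
  \<open>U\<close>, and \<open>(1 - h) * g\<close>, which vanishes off \<open>V\<close>.\<close>

lemma open_content_Un: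
  assumes "open U" "open V"
  shows "open_content (U \<union> V) \<le> open_content U + open_content V"
  unfolding open_content_def[of "U \<union> V"]
proof (rule SUP_least)
  fix f assume f: "f \<in> subordinate (U \<union> V)"
  show "ennreal (\<Lambda> f) \<le> open_content U + open_content V"
  proof (rule ennreal_le_epsilon)
    fix e :: real assume e: "0 < e"
    obtain g C where g: "continuous_on K g" "compact C" "C \<subseteq> K \<inter> (U \<union> V)" "\<And>x. x \<in> K \<Longrightarrow> 0 \<le> g x"
      "\<And>x. x \<in> K \<Longrightarrow> g x \<le> 1" "\<And>x. x \<in> K \<Longrightarrow> x \<notin> C \<Longrightarrow> g x = 0" "\<Lambda> f \<le> \<Lambda> g + e"
      by (rule cutoff[OF f e]) blast
    have cl: "closed (C - U)" "closed (C - V)" and dj: "K \<inter> (C - U) \<inter> (C - V) = {}"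
      using g assms by (auto intro: closed_Diff compact_imp_closed)
    obtain h :: "'b \<Rightarrow> real" where h: "continuous_on K h" "\<And>x. x \<in> K \<Longrightarrow> 0 \<le> h x \<and> h x \<le> 1"
      "\<And>x. x \<in> K \<inter> (C - U) \<Longrightarrow> h x = 0" "\<And>x. x \<in> K \<inter> (C - V) \<Longrightarrow> h x = 1"
      using Urysohn_compact[OF compact cl dj] by blast
    have sU: "(\<lambda>x. h x * g x) \<in> subordinate U"
    proof (rule subordinateI)
      show "h x * g x \<le> 0" if "x \<in> K" "x \<notin> U" for x
        using h(3)[of x] g(6)[of x] that by (cases "x \<in> C") auto
    qed (use g h in \<open>auto intro!: continuous_intros mult_le_one\<close>)
    have sV: "(\<lambda>x. (1 - h x) * g x) \<in> subordinate V"
    proof (rule subordinateI)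
      show "(1 - h x) * g x \<le> 0" if "x \<in> K" "x \<notin> V" for x
        using h(4)[of x] g(6)[of x] that by (cases "x \<in> C") auto
    qed (use g h in \<open>auto intro!: continuous_intros mult_le_one\<close>)
    have "\<Lambda> g = \<Lambda> (\<lambda>x. h x * g x + (1 - h x) * g x)"
      by (rule cong) (auto simp: g algebra_simps)
    also have "\<dots> = \<Lambda> (\<lambda>x. h x * g x) + \<Lambda> (\<lambda>x. (1 - h x) * g x)"
      by (intro add continuous_intros g h)
    finally have "ennreal (\<Lambda> f) \<le> ennreal (\<Lambda> (\<lambda>x. h x * g x) + \<Lambda> (\<lambda>x. (1 - h x) * g x) + e)"
      using g(7) by (intro ennreal_leI) simp
    also have "\<dots> = ennreal (\<Lambda> (\<lambda>x. h x * g x)) + ennreal (\<Lambda> (\<lambda>x. (1 - h x) * g x)) + ennreal e"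
      using e subordinateD(5)[OF sU] subordinateD(5)[OF sV] by (simp add: ennreal_plus)
    also have "\<dots> \<le> open_content U + open_content V + ennreal e"
      by (intro add_mono open_content_ge sU sV order_refl)
    finally show "ennreal (\<Lambda> f) \<le> open_content U + open_content V + ennreal e" .
  qed
qed

lemma open_content_finite_UN:
  assumes "finite I" "\<And>i. i \<in> I \<Longrightarrow> open (U i)"
  shows "open_content (\<Union>i\<in>I. U i) \<le> (\<Sum>i\<in>I. open_content (U i))"
  using assms
proof (induction I rule: finite_induct)
  case (insert i I)
  have "open_content (\<Union>i\<in>insert i I. U i) \<le> open_content (U i) + open_content (\<Union>i\<in>I. U i)"
    using open_content_Un[of "U i" "\<Union>i\<in>I. U i"] insert by (auto simp: open_UN)
  also have "\<dots> \<le> open_content (U i) + (\<Sum>i\<in>I. open_content (U i))"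
    using insert by (intro add_left_mono) auto
  finally show ?case using insert by simp
qed (simp add: open_content_null)

text \<open>The cutoff function lives on a compact set, which finitely many of the
  \<open>U i\<close> already cover. This reduces countable to finite subadditivity.\<close>

lemma open_content_UN:
  fixes U :: "nat \<Rightarrow> 'b set"
  assumes "\<And>i. open (U i)"
  shows "open_content (\<Union>i. U i) \<le> (\<Sum>i. open_content (U i))"
  unfolding open_content_def[of "\<Union>i. U i"]
proof (rule SUP_least)
  fix f assume f: "f \<in> subordinate (\<Union>i. U i)"
  show "ennreal (\<Lambda> f) \<le> (\<Sum>i. open_content (U i))"
  proof (rule ennreal_le_epsilon)
    fix e :: real assume e: "0 < e"
    obtain g C where g: "continuous_on K g" "compact C" "C \<subseteq> K \<inter> (\<Union>i. U i)" "\<And>x. x \<in> K \<Longrightarrow> 0 \<le> g x"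
      "\<And>x. x \<in> K \<Longrightarrow> g x \<le> 1" "\<And>x. x \<in> K \<Longrightarrow> x \<notin> C \<Longrightarrow> g x = 0" "\<Lambda> f \<le> \<Lambda> g + e"
      by (rule cutoff[OF f e]) blast
    obtain I where I: "finite I" "C \<subseteq> (\<Union>i\<in>I. U i)"
      using compactE_image[OF g(2), of UNIV U] assms g(3) by (metis UNIV_I le_inf_iff)
    have s: "g \<in> subordinate (\<Union>i\<in>I. U i)"
      using g I by (intro subordinateI) fastforce+
    have "ennreal (\<Lambda> f) \<le> ennreal (\<Lambda> g + e)"
      using g by (intro ennreal_leI) simp
    also have "\<dots> = ennreal (\<Lambda> g) + ennreal e"
      using subordinateD(5)[OF s] e by simp
    also have "\<dots> \<le> (\<Sum>i\<in>I. open_content (U i)) + ennreal e"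
      using open_content_ge[OF s] open_content_finite_UN[OF I(1), of U] assms
      by (intro add_right_mono) (auto intro: order_trans)
    also have "\<dots> \<le> (\<Sum>i. open_content (U i)) + ennreal e"
      using I by (intro add_right_mono sum_le_suminf) auto
    finally show "ennreal (\<Lambda> f) \<le> (\<Sum>i. open_content (U i)) + ennreal e" .
  qed
qed

lemma outer_content_approx:
  assumes "0 < e"
  obtains U where "open U" "E \<subseteq> U" "open_content U \<le> outer_content E + ennreal e"
proof -
  have "outer_content E \<le> open_content UNIV"
    unfolding outer_content_def by (intro INF_lower) auto
  \<comment> \<open>Adding \<open>e\<close> is a strict increase because the total mass is
    finite.\<close>
  then have "outer_content E < outer_content E + ennreal e"
    using assms open_content_UNIV
    by (subst (1) add_0_right[symmetric], subst ennreal_add_left_cancel_less) (auto simp: top_unique)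
  then obtain U where "open U" "E \<subseteq> U" "open_content U < outer_content E + ennreal e"
    unfolding outer_content_def[of E] INF_less_iff by auto
  then show thesis using that by auto
qed

lemma outer_measure_space: "outer_measure_space (Pow UNIV) outer_content"
  unfolding outer_measure_space_def
proof (intro conjI)
  show "positive (Pow UNIV) outer_content"
    using outer_content_open[of "{}"] by (simp add: positive_def open_content_null)
  show "increasing (Pow UNIV) outer_content"
    by (simp add: increasing_def outer_content_mono)
  show "countably_subadditive (Pow UNIV) outer_content"
    unfolding countably_subadditive_def
  proof (intro allI impI)
    fix A :: "nat \<Rightarrow> 'b set"
    show "outer_content (\<Union>i. A i) \<le> (\<Sum>i. outer_content (A i))"
    proof (rule ennreal_le_epsilon)
      fix e :: real assume e: "0 < e"
      \<comment> \<open>The tolerances \<open>e / 2^(i+1)\<close> sum to \<open>e\<close>.\<close>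
      have "\<exists>U. open U \<and> A i \<subseteq> U \<and> open_content U \<le> outer_content (A i) + ennreal (e * (1/2) ^ Suc i)" for i
        using outer_content_approx[of "e * (1/2) ^ Suc i" "A i"] e by (metis zero_less_mult_iff zero_less_power half_gt_zero_iff zero_less_one)
      then obtain U where U: "\<And>i. open (U i)" "\<And>i. A i \<subseteq> U i"
        "\<And>i. open_content (U i) \<le> outer_content (A i) + ennreal (e * (1/2) ^ Suc i)"
        by metis
      have "outer_content (\<Union>i. A i) \<le> open_content (\<Union>i. U i)"
        unfolding outer_content_def using U by (intro INF_lower) (auto intro!: open_UN)
      also have "\<dots> \<le> (\<Sum>i. open_content (U i))" by (rule open_content_UN[OF U(1)])
      also have "\<dots> \<le> (\<Sum>i. outer_content (A i) + ennreal (e * (1/2) ^ Suc i))"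
        by (intro suminf_le U) auto
      also have "\<dots> = (\<Sum>i. outer_content (A i)) + (\<Sum>i. ennreal e * ennreal ((1/2) ^ Suc i))"
        using e by (subst suminf_add[symmetric])
          (auto simp del: ennreal_suminf_cmult simp add: ennreal_mult[symmetric])
      also have "\<dots> = (\<Sum>i. outer_content (A i)) + ennreal e"
        unfolding ennreal_suminf_cmult
        by (subst suminf_ennreal_eq[OF zero_le_power power_half_series]) auto
      finally show "outer_content (\<Union>i. A i) \<le> (\<Sum>i. outer_content (A i)) + ennreal e" .
    qed
  qed
qed

text \<open>The Caratheodory inequality for \<open>U\<close>, tested on open sets. A function
  subordinate to \<open>V \<inter> U\<close> is cut off to some \<open>g\<close> living on a compact
  set \<open>C\<close>. Any \<open>k\<close> subordinate to \<open>V - C\<close> vanishes on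
  \<open>C\<close>, so \<open>g + k\<close> stays below 1 and is subordinate to \<open>V\<close>;
  and \<open>V - C\<close> contains \<open>V - U\<close>.\<close>

lemma open_content_split:
  assumes "open U" "open V"
  shows "outer_content (V \<inter> U) + outer_content (V - U) \<le> open_content V"
proof -
  have key: "ennreal (\<Lambda> f) + outer_content (V - U) \<le> open_content V" if f: "f \<in> subordinate (V \<inter> U)" for f
  proof (rule ennreal_le_epsilon)
    fix e :: real assume e: "0 < e"
    obtain g C where g: "continuous_on K g" "compact C" "C \<subseteq> K \<inter> (V \<inter> U)" "\<And>x. x \<in> K \<Longrightarrow> 0 \<le> g x"
      "\<And>x. x \<in> K \<Longrightarrow> g x \<le> 1" "\<And>x. x \<in> K \<Longrightarrow> x \<notin> C \<Longrightarrow> g x = 0" "\<Lambda> f \<le> \<Lambda> g + e"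
      by (rule cutoff[OF f e]) blast
    have s: "g \<in> subordinate V"
      using g by (intro subordinateI) fastforce+
    have ne: "subordinate (V - C) \<noteq> {}"
      using zero_subordinate by blast
    have "open (V - C)" using assms g by (auto intro: open_Diff compact_imp_closed)
    then have "outer_content (V - U) \<le> open_content (V - C)"
      unfolding outer_content_def using g(3) by (intro INF_lower) auto
    then have "ennreal (\<Lambda> g) + outer_content (V - U) \<le> ennreal (\<Lambda> g) + open_content (V - C)"
      by (intro add_left_mono)
    also have "\<dots> = (SUP k\<in>subordinate (V - C). ennreal (\<Lambda> g) + ennreal (\<Lambda> k))"
      unfolding open_content_def using ne by (simp add: ennreal_SUP_add_right)
    also have "\<dots> \<le> open_content V"
    proof (rule SUP_least)
      fix k assume k: "k \<in> subordinate (V - C)"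
      note kD = subordinateD[OF k]
      have "(\<lambda>x. g x + k x) \<in> subordinate V"
      proof (rule subordinateI)
        show "g x + k x \<le> 1" if "x \<in> K" for x
          using g(5,6)[OF that] kD(3,4)[OF that] by (cases "x \<in> C") auto
        show "g x + k x \<le> 0" if "x \<in> K" "x \<notin> V" for x
          using g(3) g(6)[OF that(1)] kD(4)[OF that(1)] that by (cases "x \<in> C") auto
      qed (use g kD in \<open>auto intro!: continuous_intros\<close>)
      from open_content_ge[OF this] show "ennreal (\<Lambda> g) + ennreal (\<Lambda> k) \<le> open_content V"
        using subordinateD(5)[OF s] kD(5) by (simp add: add g(1) kD(1))
    qed
    finally have *: "ennreal (\<Lambda> g) + outer_content (V - U) \<le> open_content V" .
    have "ennreal (\<Lambda> f) \<le> ennreal (\<Lambda> g) + ennreal e"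
      using g(7) subordinateD(5)[OF s] e by (metis ennreal_leI ennreal_plus less_imp_le)
    then have "ennreal (\<Lambda> f) + outer_content (V - U) \<le> ennreal (\<Lambda> g) + ennreal e + outer_content (V - U)"
      by (rule add_right_mono)
    also have "\<dots> \<le> open_content V + ennreal e"
      using add_right_mono[OF *, of "ennreal e"] by (simp add: ac_simps)
    finally show "ennreal (\<Lambda> f) + outer_content (V - U) \<le> open_content V + ennreal e" .
  qed
  have ne: "subordinate (V \<inter> U) \<noteq> {}"
    using zero_subordinate by blast
  have "outer_content (V \<inter> U) + outer_content (V - U)
      = (SUP f\<in>subordinate (V \<inter> U). ennreal (\<Lambda> f) + outer_content (V - U))"
    using assms ne by (simp add: outer_content_open open_Int open_content_def ennreal_SUP_add_left)
  also have "\<dots> \<le> open_content V"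
    using key by (intro SUP_least)
  finally show ?thesis .
qed

section \<open>The Riesz measure on the Borel sets\<close>

lemma open_in_lambda_system: "open U \<Longrightarrow> U \<in> lambda_system UNIV (Pow UNIV) outer_content"
  unfolding algebra.lambda_system_eq[OF algebra_Pow]
proof (intro CollectI conjI ballI)
  fix E :: "'b set" assume U: "open U"
  have oms: "subadditive (Pow UNIV) outer_content"
    using outer_measure_space ring_of_sets.countably_subadditive_subadditive[of UNIV "Pow UNIV" outer_content]
      algebra_Pow[of UNIV] by (auto simp: outer_measure_space_def algebra_def)
  show "outer_content (E \<inter> U) + outer_content (E - U) = outer_content E"
  proof (rule antisym)
    \<comment> \<open>Every open \<open>V\<close> around \<open>E\<close> satisfies the inequality
      of \<open>open_content_split\<close>; the infimum over \<open>V\<close> transfers it to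
      \<open>E\<close>.\<close>
    show "outer_content (E \<inter> U) + outer_content (E - U) \<le> outer_content E"
      unfolding outer_content_def[of E]
    proof (rule INF_greatest)
      fix V assume "V \<in> {V. open V \<and> E \<subseteq> V}"
      then have V: "open V" "E \<subseteq> V" by auto
      have "outer_content (E \<inter> U) + outer_content (E - U) \<le> outer_content (V \<inter> U) + outer_content (V - U)"
        using V by (intro add_mono outer_content_mono) auto
      also have "\<dots> \<le> open_content V" by (rule open_content_split[OF U V(1)])
      finally show "outer_content (E \<inter> U) + outer_content (E - U) \<le> open_content V" .
    qed
    have "outer_content ((E \<inter> U) \<union> (E - U)) \<le> outer_content (E \<inter> U) + outer_content (E - U)"
      by (rule subadditiveD[OF oms]) auto
    then show "outer_content E \<le> outer_content (E \<inter> U) + outer_content (E - U)"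
      by (simp add: Un_Diff_Int Un_commute)
  qed
qed auto

definition riesz_measure :: "'b measure" where
  "riesz_measure = measure_of UNIV (sets borel) outer_content"

text \<open>Caratheodory's theorem gives a measure on the lambda system, a sigma-algebra that
  contains the open sets and hence all Borel sets.\<close>

lemma measure_space_borel: "measure_space UNIV (sets borel) outer_content"
proof (rule measure_down)
  show ms: "measure_space UNIV (lambda_system UNIV (Pow UNIV) outer_content) outer_content"
    by (rule sigma_algebra.caratheodory_lemma[OF sigma_algebra_Pow outer_measure_space])
  show "sigma_algebra UNIV (sets (borel :: 'b measure))"
    using sets.sigma_algebra_axioms[of "borel :: 'b measure"] by simp
  have "sigma_sets UNIV {S. open S} \<subseteq> lambda_system UNIV (Pow UNIV) outer_content"
    using ms open_in_lambda_system
    by (intro sigma_algebra.sigma_sets_subset) (auto simp: measure_space_def)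
  then show "sets borel \<subseteq> lambda_system UNIV (Pow UNIV) outer_content"
    by (simp add: borel_def)
qed

lemma sets_riesz_measure [simp, measurable_cong]: "sets riesz_measure = sets borel"
  unfolding riesz_measure_def using sets.sigma_sets_eq[of "borel :: 'b measure"] by simp

lemma space_riesz_measure [simp]: "space riesz_measure = UNIV"
  unfolding riesz_measure_def by simp

lemma emeasure_riesz_measure: "B \<in> sets borel \<Longrightarrow> emeasure riesz_measure B = outer_content B"
  unfolding riesz_measure_def using measure_space_borel
  by (intro emeasure_measure_of_sigma) (auto simp: measure_space_def)

lemma emeasure_riesz_measure_open: "open U \<Longrightarrow> emeasure riesz_measure U = open_content U"
  by (simp add: emeasure_riesz_measure outer_content_open)

lemma emeasure_riesz_measure_UNIV: "emeasure riesz_measure UNIV = ennreal (\<Lambda> (\<lambda>x. 1))"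
  by (simp add: emeasure_riesz_measure_open open_content_UNIV)

lemma closed_K: "closed K"
  by (rule compact_imp_closed[OF compact])

lemma emeasure_riesz_measure_Compl: "emeasure riesz_measure (- K) = 0"
  using closed_K by (simp add: emeasure_riesz_measure_open open_Compl open_content_null)

sublocale riesz: finite_measure riesz_measure
  by standard (simp add: emeasure_riesz_measure_UNIV)

text \<open>Outer regularity at \<open>- B\<close>: the complement of an open \<open>U\<close>
  around \<open>- B\<close> is a closed subset of \<open>B\<close>, and intersecting it with
  \<open>K\<close>, which carries all the mass, makes it compact.\<close>

lemma riesz_measure_inner_regular:
  assumes B: "B \<in> sets borel" and e: "0 < e"
  obtains C where "compact C" "C \<subseteq> B" "emeasure riesz_measure B \<le> emeasure riesz_measure C + ennreal e"
proof -
  have B': "- B \<in> sets borel"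
    using B by (simp add: borel_comp)
  obtain U where U: "open U" "- B \<subseteq> U" "open_content U \<le> outer_content (- B) + ennreal e"
    by (rule outer_content_approx[OF e])
  let ?M = "riesz_measure" and ?C = "K \<inter> - U"
  have C: "compact ?C"
    using U(1) compact by (intro compact_Int_closed) auto
  have mU: "measure ?M U \<le> measure ?M (- B) + e"
    using U(3) e unfolding emeasure_riesz_measure[OF B', symmetric] emeasure_riesz_measure_open[OF U(1), symmetric]
    by (simp add: riesz.emeasure_eq_measure flip: ennreal_plus)
  have "measure ?M (- K) = 0"
    using emeasure_riesz_measure_Compl by (simp add: measure_def)
  then have "measure ?M (- U) = measure ?M ?C"
    using U(1) closed_K
    by (intro riesz.finite_measure_eq_AE) (auto intro!: AE_I[of _ _ "- K"] simp: emeasure_riesz_measure_Compl)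
  moreover have "measure ?M (- U) = measure ?M UNIV - measure ?M U"
    using riesz.finite_measure_compl[of U] U(1) by (simp add: Compl_eq_Diff_UNIV)
  moreover have "measure ?M (- B) = measure ?M UNIV - measure ?M B"
    using riesz.finite_measure_compl[of B] B by (simp add: Compl_eq_Diff_UNIV)
  ultimately have "measure ?M B \<le> measure ?M ?C + e"
    using mU by simp
  then have "emeasure ?M B \<le> emeasure ?M ?C + ennreal e"
    using e by (simp add: riesz.emeasure_eq_measure flip: ennreal_plus)
  then show thesis
    using that[OF C] U(2) by auto
qed

end

section \<open>Integrals against the Riesz measure\<close>

lemma sum_truncations:
  fixes t :: real assumes "0 \<le> t" shows "(\<Sum>i<n. min (max (t - real i) 0) 1) = min t (real n)"
  using assms by (induction n) (auto simp: min_def max_def)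

text \<open>The sum counts integers \<open>i \<ge> 0\<close> below \<open>t\<close>, of which there
  are at most the ceiling of \<open>t\<close>.\<close>

lemma sum_levels_le:
  fixes t :: real assumes "0 \<le> t" shows "(\<Sum>i<n. indicator {real i<..} t) \<le> t + 1"
proof (induction n)
  case (Suc n)
  have "(\<Sum>i<n. indicator {real i<..} t) \<le> (\<Sum>i<n. 1::real)"
    by (intro sum_mono) (auto simp: indicator_def)
  with Suc show ?case by (auto simp: indicator_def)
qed (use assms in simp)

context positive_functional
begin

lemma set_integrable_riesz:
  fixes f :: "'b \<Rightarrow> real"
  assumes "continuous_on K f"
  shows "set_integrable riesz_measure K f"
proof -
  have "compact (f ` K)" by (rule compact_continuous_image[OF assms compact])
  then obtain B where B: "\<And>x. x \<in> K \<Longrightarrow> \<bar>f x\<bar> \<le> B"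
    by (metis compact_imp_bounded bounded_iff image_eqI real_norm_def)
  have "(\<lambda>x. indicator K x *\<^sub>R f x) \<in> borel_measurable borel"
    using assms closed_K by (intro borel_measurable_continuous_on_indicator) auto
  then show ?thesis
    unfolding set_integrable_def using B
    by (intro riesz.integrable_const_bound[of _ "\<bar>B\<bar>"])
      (fastforce simp: indicator_def cong: measurable_cong_sets)+
qed

lemma set_integral_riesz_const: "(LINT x:K|riesz_measure. c) = c * \<Lambda> (\<lambda>x. 1)"
proof -
  have "measure riesz_measure K = measure riesz_measure UNIV"
    using closed_K
    by (intro riesz.finite_measure_eq_AE) (auto intro!: AE_I[of _ _ "- K"] simp: emeasure_riesz_measure_Compl)
  also have "\<dots> = \<Lambda> (\<lambda>x. 1)"
    by (simp add: measure_def emeasure_riesz_measure_UNIV nonneg)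
  finally show ?thesis
    using closed_K by (simp add: set_lebesgue_integral_def)
qed

text \<open>On \<open>K\<close> the function is cut into slices of height 1. The slice
  \<open>?g i\<close> is at most the indicator of the set where \<open>f > i\<close>, and these
  indicators sum to at most \<open>f + 1\<close>. The surplus 1 produces the error term, the total
  mass.\<close>

lemma le_set_integral_riesz_aux:
  assumes f: "continuous_on K f" "\<And>x. x \<in> K \<Longrightarrow> 0 \<le> f x"
  shows "\<Lambda> f \<le> (LINT x:K|riesz_measure. f x) + \<Lambda> (\<lambda>x. 1)"
proof -
  have "compact (f ` K)" by (rule compact_continuous_image[OF f(1) compact])
  then obtain B where B: "\<And>x. x \<in> K \<Longrightarrow> \<bar>f x\<bar> \<le> B"
    by (metis compact_imp_bounded bounded_iff image_eqI real_norm_def)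
  obtain n :: nat where n: "B \<le> real n" using real_arch_simple by blast
  let ?g = "\<lambda>i x. min (max (f x - real i) 0) 1"
  let ?S = "\<lambda>i. K \<inter> f -` {real i<..}"
  have cg: "continuous_on K (?g i)" for i
    by (intro continuous_intros f)
  have S: "?S i \<in> sets borel" "\<Lambda> (?g i) \<le> measure riesz_measure (?S i)" for i
  proof -
    obtain U where U: "open U" "U \<inter> K = f -` {real i<..} \<inter> K"
      using f(1) unfolding continuous_on_open_invariant by (meson open_greaterThan)
    then have eq: "?S i = U \<inter> K" by auto
    show b: "?S i \<in> sets borel"
      unfolding eq using U(1) closed_K by (intro sets.Int borel_open borel_closed)
    have "?g i \<in> subordinate U"
      using U(2) by (intro subordinateI cg) (auto simp: min_def max_def)
    from open_content_ge[OF this] have "ennreal (\<Lambda> (?g i)) \<le> emeasure riesz_measure U"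
      by (simp add: emeasure_riesz_measure_open U)
    also have "\<dots> = emeasure riesz_measure (?S i)"
      using U(1) closed_K b unfolding eq
      by (intro emeasure_eq_AE) (auto intro!: AE_I[of _ _ "- K"] simp: emeasure_riesz_measure_Compl)
    finally show "\<Lambda> (?g i) \<le> measure riesz_measure (?S i)"
      by (simp add: riesz.emeasure_eq_measure)
  qed
  have "\<Lambda> f = \<Lambda> (\<lambda>x. \<Sum>i<n. ?g i x)"
  proof (rule cong[OF f(1)])
    show "f x = (\<Sum>i<n. ?g i x)" if "x \<in> K" for x
      using sum_truncations[OF f(2)[OF that], of n] B[OF that] n by simp
  qed
  also have "\<dots> = (\<Sum>i<n. \<Lambda> (?g i))"
    using cg by (intro sum) auto
  also have "\<dots> \<le> (\<Sum>i<n. measure riesz_measure (?S i))"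
    by (intro sum_mono S)
  also have "\<dots> = (\<integral>x. (\<Sum>i<n. indicator (?S i) x) \<partial>riesz_measure)"
    using S(1) by (subst Bochner_Integration.integral_sum) (auto simp: riesz.emeasure_eq_measure)
  also have "\<dots> \<le> (LINT x:K|riesz_measure. f x + 1)"
    unfolding set_lebesgue_integral_def
  proof (rule integral_mono)
    show "integrable riesz_measure (\<lambda>x. \<Sum>i<n. indicator (?S i) x :: real)"
      using S(1) by (intro Bochner_Integration.integrable_sum) (auto simp: riesz.emeasure_eq_measure)
    show "integrable riesz_measure (\<lambda>x. indicator K x *\<^sub>R (f x + 1))"
      using set_integrable_riesz[of "\<lambda>x. f x + 1"] f(1)
      by (simp add: set_integrable_def continuous_on_add)
    show "(\<Sum>i<n. indicator (?S i) x) \<le> indicator K x *\<^sub>R (f x + 1)" for x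
    proof (cases "x \<in> K")
      case True
      then have "(\<Sum>i<n. indicator (?S i) x :: real) = (\<Sum>i<n. indicator {real i<..} (f x))"
        by (intro sum.cong) (auto simp: indicator_def)
      then show ?thesis
        using sum_levels_le[OF f(2)[OF True], of n] True by simp
    qed simp
  qed
  also have "\<dots> = (LINT x:K|riesz_measure. f x) + \<Lambda> (\<lambda>x. 1)"
    using set_integral_riesz_const[of 1] set_integrable_riesz[OF f(1)] set_integrable_riesz[of "\<lambda>x. 1"]
    by (subst set_integral_add) auto
  finally show ?thesis .
qed

text \<open>The error in \<open>le_set_integral_riesz_aux\<close> is the same for every function, so
  multiplying \<open>f\<close> by a large \<open>n\<close> makes it negligible.\<close>

lemma le_set_integral_riesz:
  assumes f: "continuous_on K f"
  shows "\<Lambda> f \<le> (LINT x:K|riesz_measure. f x)"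
proof -
  let ?I = "\<lambda>f. LINT x:K|riesz_measure. f x" and ?m = "\<Lambda> (\<lambda>x. 1)"
  have "compact (f ` K)" by (rule compact_continuous_image[OF f compact])
  then obtain B where B: "\<And>x. x \<in> K \<Longrightarrow> \<bar>f x\<bar> \<le> B"
    by (metis compact_imp_bounded bounded_iff image_eqI real_norm_def)
  have *: "real n * (\<Lambda> f - ?I f) \<le> ?m" for n
  proof -
    have i: "set_integrable riesz_measure K (\<lambda>x. real n * f x)" "set_integrable riesz_measure K (\<lambda>x. real n * B)"
      using f by (auto intro!: set_integrable_riesz continuous_intros)
    \<comment> \<open>The constant \<open>n * B\<close> makes the function nonnegative on
      \<open>K\<close>. It contributes equally to both sides and cancels.\<close>
    have "\<Lambda> (\<lambda>x. real n * f x + real n * B) \<le> ?I (\<lambda>x. real n * f x + real n * B) + ?m"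
    proof (rule le_set_integral_riesz_aux)
      show "0 \<le> real n * f x + real n * B" if "x \<in> K" for x
        using B[OF that] by (simp add: abs_le_iff flip: distrib_left)
    qed (intro continuous_intros f)
    also have "?I (\<lambda>x. real n * f x + real n * B) = real n * ?I f + real n * B * ?m"
      using i by (subst set_integral_add) (auto simp: set_integral_riesz_const)
    also have "\<Lambda> (\<lambda>x. real n * f x + real n * B) = real n * \<Lambda> f + real n * B * ?m"
      using f by (subst add) (auto intro!: continuous_intros simp: scale const[of "real n * B"])
    finally show ?thesis by (simp add: algebra_simps)
  qed
  show ?thesis
  proof (rule ccontr)
    assume "\<not> ?thesis"
    then have "0 < \<Lambda> f - ?I f" by simp
    then obtain n where "?m < real n * (\<Lambda> f - ?I f)"
      using reals_Archimedean3 by blast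
    with *[of n] show False by simp
  qed
qed

text \<open>The missing inequality is \<open>le_set_integral_riesz\<close> for
  \<open>- f\<close>.\<close>

theorem set_integral_riesz:
  assumes f: "continuous_on K f"
  shows "(LINT x:K|riesz_measure. f x) = \<Lambda> f"
proof -
  have "\<Lambda> (\<lambda>x. - f x) \<le> (LINT x:K|riesz_measure. - f x)"
    by (intro le_set_integral_riesz continuous_intros f)
  moreover have "\<Lambda> (\<lambda>x. - f x) = - \<Lambda> f"
    using scale[OF f, of "-1"] by simp
  moreover have "(LINT x:K|riesz_measure. - f x) = - (LINT x:K|riesz_measure. f x)"
    by (simp add: set_lebesgue_integral_def)
  ultimately show ?thesis
    using le_set_integral_riesz[OF f] by simp
qed

end

section \<open>Quadratic modules\<close>

text \<open>Moves the factor 1/4 of a polarization identity out of the way, so that a plain ring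
  identity remains to be checked.\<close>

lemma scaleR_quarter:
  fixes z :: "'a::real_vector"
  assumes "w = z + z + (z + z)" shows "z = (1/4) *\<^sub>R w"
  using assms by (simp flip: scaleR_2)

lemma of_nat_eq_scaleR: "(of_nat n :: 'a::real_algebra_1) = real n *\<^sub>R 1"
  by (simp add: scaleR_conv_of_real)

context
  fixes Q :: "'a::{real_algebra_1, comm_ring_1} set"
  assumes Q: "quadratic_module Q"
begin

lemma quadratic_module_one: "1 \<in> Q"
  and quadratic_module_add: "q \<in> Q \<Longrightarrow> r \<in> Q \<Longrightarrow> q + r \<in> Q"
  and quadratic_module_square_mult: "q \<in> Q \<Longrightarrow> a\<^sup>2 * q \<in> Q"
  using Q by (auto simp: quadratic_module_def)

lemma quadratic_module_square: "a\<^sup>2 \<in> Q"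
  using quadratic_module_square_mult[OF quadratic_module_one] by simp

lemma quadratic_module_zero: "0 \<in> Q"
  using quadratic_module_square[of 0] by simp

lemma quadratic_module_scaleR:
  assumes "0 \<le> c" "q \<in> Q" shows "c *\<^sub>R q \<in> Q"
proof -
  have "c *\<^sub>R q = (sqrt c *\<^sub>R 1)\<^sup>2 * q"
    using assms by (simp add: power2_eq_square)
  then show ?thesis using quadratic_module_square_mult[OF assms(2)] by simp
qed

lemma quadratic_module_const: "0 \<le> c \<Longrightarrow> c *\<^sub>R 1 \<in> Q"
  using quadratic_module_scaleR quadratic_module_one by blast

lemma sums_of_squares_mult:
  assumes "s \<in> sums_of_squares" "q \<in> Q" shows "s * q \<in> Q"
proof -
  obtain xs where s: "s = (\<Sum>x\<leftarrow>xs. x\<^sup>2)" using assms by (auto simp: sums_of_squares_def)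
  show ?thesis unfolding s
    by (induction xs) (auto simp: quadratic_module_zero distrib_right
        intro!: quadratic_module_add quadratic_module_square_mult assms)
qed

lemma sums_of_squares_subset: "sums_of_squares \<subseteq> Q"
  using sums_of_squares_mult[OF _ quadratic_module_one] by auto

text \<open>Polarization writes \<open>4 * y\<close> as \<open>(y + 1)^2 - (y - 1)^2\<close>, so
  only squares times \<open>x\<close> and squares times \<open>- x\<close> occur. Hence the elements
  of \<open>Q\<close> whose negatives are in \<open>Q\<close> form an ideal.\<close>

lemma quadratic_module_ideal:
  assumes "x \<in> Q" "- x \<in> Q" shows "x * y \<in> Q"
proof -
  have "x * y = (1/4) *\<^sub>R ((y + 1)\<^sup>2 * x + (y - 1)\<^sup>2 * (- x))"
    by (intro scaleR_quarter) (simp add: power2_eq_square algebra_simps)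
  also have "\<dots> \<in> Q"
    by (intro quadratic_module_scaleR quadratic_module_add quadratic_module_square_mult assms) simp
  finally show ?thesis .
qed

end

lemma quadratic_module_sums_of_squares:
  "quadratic_module (sums_of_squares :: 'a::{real_algebra_1, comm_ring_1} set)"
  unfolding quadratic_module_def
proof (intro conjI ballI allI)
  show "(1::'a) \<in> sums_of_squares"
    by (auto simp: sums_of_squares_def intro!: exI[of _ "[1]"])
next
  fix q r :: 'a assume "q \<in> sums_of_squares" "r \<in> sums_of_squares"
  then obtain xs ys where "q = (\<Sum>x\<leftarrow>xs. x\<^sup>2)" "r = (\<Sum>x\<leftarrow>ys. x\<^sup>2)"
    by (auto simp: sums_of_squares_def)
  then show "q + r \<in> sums_of_squares"
    by (auto simp: sums_of_squares_def intro!: exI[of _ "xs @ ys"])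
next
  fix a q :: 'a assume "q \<in> sums_of_squares"
  then obtain xs where "q = (\<Sum>x\<leftarrow>xs. x\<^sup>2)"
    by (auto simp: sums_of_squares_def)
  then have "a\<^sup>2 * q = (\<Sum>x\<leftarrow>map ((*) a) xs. x\<^sup>2)"
    by (simp add: sum_list_const_mult comp_def power_mult_distrib)
  then show "a\<^sup>2 * q \<in> sums_of_squares"
    unfolding sums_of_squares_def by blast
qed

section \<open>Adjoining an element, and maximal proper quadratic modules\<close>

definition adjoin :: "'a::{real_algebra_1, comm_ring_1} set \<Rightarrow> 'a \<Rightarrow> 'a set" where
  "adjoin Q a = {q + a * s | q s. q \<in> Q \<and> s \<in> sums_of_squares}"

lemma quadratic_module_adjoin:
  fixes Q :: "'a::{real_algebra_1, comm_ring_1} set"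
  assumes Q: "quadratic_module Q"
  shows "quadratic_module (adjoin Q a)" "Q \<subseteq> adjoin Q a" "a \<in> adjoin Q a"
proof -
  note S = quadratic_module_sums_of_squares[where 'a = 'a]
  show sub: "Q \<subseteq> adjoin Q a"
  proof
    fix q assume "q \<in> Q"
    then show "q \<in> adjoin Q a"
      unfolding adjoin_def using quadratic_module_zero[OF S] by (intro CollectI exI[of _ q] exI[of _ 0]) simp
  qed
  show "a \<in> adjoin Q a"
    unfolding adjoin_def using quadratic_module_zero[OF Q] quadratic_module_one[OF S]
    by (intro CollectI exI[of _ 0] exI[of _ 1]) simp
  show "quadratic_module (adjoin Q a)"
    unfolding quadratic_module_def
  proof (intro conjI ballI allI)
    show "1 \<in> adjoin Q a" using sub quadratic_module_one[OF Q] by auto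
  next
    fix x y assume "x \<in> adjoin Q a" "y \<in> adjoin Q a"
    then obtain q s q' s' where "x = q + a * s" "y = q' + a * s'" "q \<in> Q" "q' \<in> Q"
      "s \<in> sums_of_squares" "s' \<in> sums_of_squares"
      by (auto simp: adjoin_def)
    then show "x + y \<in> adjoin Q a"
      unfolding adjoin_def using quadratic_module_add[OF Q, of q q'] quadratic_module_add[OF S, of s s']
      by (intro CollectI exI[of _ "q + q'"] exI[of _ "s + s'"]) (simp add: algebra_simps)
  next
    fix b x assume "x \<in> adjoin Q a"
    then obtain q s where "x = q + a * s" "q \<in> Q" "s \<in> sums_of_squares"
      by (auto simp: adjoin_def)
    then show "b\<^sup>2 * x \<in> adjoin Q a"
      unfolding adjoin_def using quadratic_module_square_mult[OF Q, of q b] quadratic_module_square_mult[OF S, of s b]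
      by (intro CollectI exI[of _ "b\<^sup>2 * q"] exI[of _ "b\<^sup>2 * s"]) (simp add: algebra_simps)
  qed
qed

lemma quadratic_module_Union_chain:
  assumes "\<C> \<noteq> {}" "subset.chain {Q. quadratic_module Q \<and> P Q} \<C>"
  shows "quadratic_module (\<Union> \<C>)"
proof -
  have C: "\<And>Q. Q \<in> \<C> \<Longrightarrow> quadratic_module Q" "\<And>Q R. Q \<in> \<C> \<Longrightarrow> R \<in> \<C> \<Longrightarrow> Q \<subseteq> R \<or> R \<subseteq> Q"
    using assms(2) by (auto simp: subset.chain_def)
  show ?thesis
    unfolding quadratic_module_def
  proof (intro conjI ballI allI)
    show "1 \<in> \<Union> \<C>" using assms(1) C(1) quadratic_module_one by blast
    show "q + r \<in> \<Union> \<C>" if qr: "q \<in> \<Union> \<C>" "r \<in> \<Union> \<C>" for q r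
    proof -
      obtain Q R where "q \<in> Q" "r \<in> R" "Q \<in> \<C>" "R \<in> \<C>" using qr by blast
      then have "Q \<union> R \<in> \<C>" "q \<in> Q \<union> R" "r \<in> Q \<union> R"
        using C(2)[of Q R] by (auto simp: sup_absorb1 sup_absorb2)
      then show ?thesis
        using quadratic_module_add[OF C(1)] by blast
    qed
    show "a\<^sup>2 * q \<in> \<Union> \<C>" if "q \<in> \<Union> \<C>" for a q
      using that by (blast intro: quadratic_module_square_mult C(1))
  qed
qed

text \<open>Zorn's lemma: the union of a nonempty chain of quadratic modules omitting
  \<open>- 1\<close> is again one, and anything larger than \<open>M\<close> still contains
  \<open>Q\<close>.\<close>

lemma maximal_quadratic_module_exists:
  assumes "quadratic_module Q" "- 1 \<notin> Q"
  obtains M where "quadratic_module M" "Q \<subseteq> M" "- 1 \<notin> M"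
    "\<And>N. quadratic_module N \<Longrightarrow> M \<subseteq> N \<Longrightarrow> - 1 \<notin> N \<Longrightarrow> N = M"
proof -
  let ?A = "{N. quadratic_module N \<and> (Q \<subseteq> N \<and> - 1 \<notin> N)}"
  have "\<exists>M\<in>?A. \<forall>X\<in>?A. M \<subseteq> X \<longrightarrow> X = M"
  proof (rule subset_Zorn_nonempty)
    show "?A \<noteq> {}" using assms by auto
    fix \<C> assume C: "\<C> \<noteq> {}" "subset.chain ?A \<C>"
    have "quadratic_module (\<Union> \<C>)" by (rule quadratic_module_Union_chain[OF C])
    moreover have "\<And>N. N \<in> \<C> \<Longrightarrow> Q \<subseteq> N" "\<And>N. N \<in> \<C> \<Longrightarrow> - 1 \<notin> N"
      using C(2) by (auto simp: subset.chain_def)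
    then have "Q \<subseteq> \<Union> \<C>" "- 1 \<notin> \<Union> \<C>"
      using C(1) by blast+
    ultimately show "\<Union> \<C> \<in> ?A" by auto
  qed
  then obtain M where M: "M \<in> ?A" "\<forall>X\<in>?A. M \<subseteq> X \<longrightarrow> X = M" ..
  show thesis
    by (rule that[of M]) (use M in auto)
qed

section \<open>The character of a maximal Archimedean quadratic module\<close>

locale maximal_archimedean =
  fixes M :: "'a::{real_algebra_1, comm_ring_1} set"
  assumes qm: "quadratic_module M"
    and proper: "- 1 \<notin> M"
    and maximal: "\<And>N. quadratic_module N \<Longrightarrow> M \<subseteq> N \<Longrightarrow> - 1 \<notin> N \<Longrightarrow> N = M"
    and archimedean: "\<And>a. \<exists>N::nat. of_nat N + a \<in> M \<and> of_nat N - a \<in> M"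
begin

lemmas add = quadratic_module_add[OF qm]
  and square_mult = quadratic_module_square_mult[OF qm]
  and square = quadratic_module_square[OF qm]
  and scaleR = quadratic_module_scaleR[OF qm]
  and const = quadratic_module_const[OF qm]
  and sos_mult = sums_of_squares_mult[OF qm]
  and ideal = quadratic_module_ideal[OF qm]

lemma adjoin_improper: "a \<notin> M \<Longrightarrow> - 1 \<in> adjoin M a"
  using maximal[of "adjoin M a"] quadratic_module_adjoin[OF qm, of a] by auto

text \<open>If \<open>-1 = m + a s = m' - a t\<close> then \<open>-(s + t) = t m + s m' \<in> M\<close>, so \<open>s\<close> lies in the ideal
  \<open>M \<inter> -M\<close> and \<open>-1 \<in> M\<close>.\<close>

lemma total: "a \<in> M \<or> - a \<in> M"
proof (rule ccontr)
  assume "\<not> ?thesis"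
  then have "- 1 \<in> adjoin M a" "- 1 \<in> adjoin M (- a)" using adjoin_improper by auto
  then obtain m s m' t where ms: "- 1 = m + a * s" "m \<in> M" "s \<in> sums_of_squares"
    and mt: "- 1 = m' + (- a) * t" "m' \<in> M" "t \<in> sums_of_squares"
    by (auto simp: adjoin_def)
  have st: "s \<in> M" "t \<in> M"
    using ms mt sums_of_squares_subset[OF qm] by auto
  have "- s = t * (- 1) + s * (- 1) + t" by simp
  also have "\<dots> = t * (m + a * s) + s * (m' + (- a) * t) + t"
    unfolding ms(1)[symmetric] mt(1)[symmetric] ..
  also have "\<dots> = t * m + s * m' + t"
    by (simp add: algebra_simps)
  also have "\<dots> \<in> M"
    using ms mt st by (intro add sos_mult) auto
  finally have "- s \<in> M" .
  then have "s * a \<in> M"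
    using st ideal by blast
  then have "m + a * s \<in> M" using add ms by (simp add: mult.commute)
  then show False using proper ms by simp
qed

lemma const_mem_iff: "c *\<^sub>R 1 \<in> M \<longleftrightarrow> 0 \<le> c"
proof
  assume c: "c *\<^sub>R 1 \<in> M"
  show "0 \<le> c"
  proof (rule ccontr)
    assume "\<not> 0 \<le> c"
    then have "(- 1 / c) *\<^sub>R (c *\<^sub>R 1) \<in> M" by (intro scaleR c) (simp add: field_simps)
    then show False using proper \<open>\<not> 0 \<le> c\<close> by simp
  qed
qed (rule const)

text \<open>A Dedekind cut. By \<open>bound\<close> and \<open>cut_le\<close> the set is nonempty
  and bounded above, so \<open>Sup\<close> is a true supremum.\<close>

definition val :: "'a \<Rightarrow> real" where
  "val a = Sup {r. a - r *\<^sub>R 1 \<in> M}"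

lemma bound: "\<exists>N::nat. a - (- real N) *\<^sub>R 1 \<in> M \<and> real N *\<^sub>R 1 - a \<in> M"
  using archimedean[of a] by (simp add: of_nat_eq_scaleR[where 'a = 'a] add.commute)

lemma cut_le:
  assumes "a - r *\<^sub>R 1 \<in> M" "t *\<^sub>R 1 - a \<in> M" shows "r \<le> t"
  using add[OF assms] const_mem_iff[of "t - r"] by (simp add: algebra_simps)

lemma mem_lower: "r < val a \<Longrightarrow> a - r *\<^sub>R 1 \<in> M"
proof -
  assume r: "r < val a"
  obtain N :: nat where "a - (- real N) *\<^sub>R 1 \<in> M" using bound[of a] by (elim exE conjE)
  then have "{r. a - r *\<^sub>R 1 \<in> M} \<noteq> {}" by blast
  from less_cSupD[OF this r[unfolded val_def]] obtain r' where r': "r < r'" "a - r' *\<^sub>R 1 \<in> M"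
    by blast
  then have "(a - r' *\<^sub>R 1) + (r' - r) *\<^sub>R 1 \<in> M" by (intro add const) auto
  then show ?thesis by (simp add: algebra_simps)
qed

lemma le_val: "a - r *\<^sub>R 1 \<in> M \<Longrightarrow> r \<le> val a"
proof -
  assume r: "a - r *\<^sub>R 1 \<in> M"
  obtain N :: nat where "real N *\<^sub>R 1 - a \<in> M" using bound[of a] by (elim exE conjE)
  then have "bdd_above {r. a - r *\<^sub>R 1 \<in> M}"
    using cut_le by (intro bdd_aboveI[of _ "real N"]) auto
  then show ?thesis
    unfolding val_def using r by (intro cSup_upper) auto
qed

lemma mem_upper: "val a < r \<Longrightarrow> r *\<^sub>R 1 - a \<in> M"
  using total[of "a - r *\<^sub>R 1"] le_val[of a r] by auto

text \<open>The margin \<open>e\<close> on both sides avoids deciding whether the supremum is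
  attained.\<close>

lemma val_eqI:
  assumes "\<And>e. 0 < e \<Longrightarrow> a - (v - e) *\<^sub>R 1 \<in> M" "\<And>e. 0 < e \<Longrightarrow> (v + e) *\<^sub>R 1 - a \<in> M"
  shows "val a = v"
proof (rule antisym)
  show "val a \<le> v"
  proof (rule field_le_epsilon)
    fix e :: real assume "0 < e"
    then show "val a \<le> v + e"
      using cut_le[OF mem_lower[of "val a - e / 2" a] assms(2)[of "e/2"]] by simp
  qed
  show "v \<le> val a"
  proof (rule field_le_epsilon)
    fix e :: real assume "0 < e"
    then show "v \<le> val a + e" using le_val[OF assms(1)[of e]] by simp
  qed
qed

lemma val_add: "val (a + b) = val a + val b"
proof (rule val_eqI)
  fix e :: real assume "0 < e"
  then have "(a - (val a - e/2) *\<^sub>R 1) + (b - (val b - e/2) *\<^sub>R 1) \<in> M"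
    "((val a + e/2) *\<^sub>R 1 - a) + ((val b + e/2) *\<^sub>R 1 - b) \<in> M"
    by (intro add mem_lower mem_upper; simp)+
  moreover have "(a - (val a - e/2) *\<^sub>R 1) + (b - (val b - e/2) *\<^sub>R 1) = a + b - (val a + val b - e) *\<^sub>R 1"
    "((val a + e/2) *\<^sub>R 1 - a) + ((val b + e/2) *\<^sub>R 1 - b) = (val a + val b + e) *\<^sub>R 1 - (a + b)"
    by (simp_all add: algebra_simps flip: scaleR_add_left)
  ultimately show "a + b - (val a + val b - e) *\<^sub>R 1 \<in> M" "(val a + val b + e) *\<^sub>R 1 - (a + b) \<in> M"
    by simp_all
qed

lemma val_const: "val (c *\<^sub>R 1) = c"
  by (rule val_eqI) (simp_all add: const flip: scaleR_diff_left)

lemma val_pos_scaleR: "0 < c \<Longrightarrow> val (c *\<^sub>R a) = c * val a"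
proof (rule val_eqI)
  fix e :: real assume c: "0 < c" and "0 < e"
  then have "c *\<^sub>R (a - (val a - e/c) *\<^sub>R 1) \<in> M" "c *\<^sub>R ((val a + e/c) *\<^sub>R 1 - a) \<in> M"
    by (intro scaleR mem_lower mem_upper; simp)+
  moreover have "c *\<^sub>R (a - (val a - e/c) *\<^sub>R 1) = c *\<^sub>R a - (c * val a - e) *\<^sub>R 1"
    "c *\<^sub>R ((val a + e/c) *\<^sub>R 1 - a) = (c * val a + e) *\<^sub>R 1 - c *\<^sub>R a"
    using c by (simp_all add: algebra_simps)
  ultimately show "c *\<^sub>R a - (c * val a - e) *\<^sub>R 1 \<in> M" "(c * val a + e) *\<^sub>R 1 - c *\<^sub>R a \<in> M"
    by simp_all
qed

lemma val_zero: "val 0 = 0"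
  using val_const[of 0] by simp

lemma val_minus: "val (- a) = - val a"
  using val_add[of a "- a"] val_zero by simp

lemma val_scaleR: "val (c *\<^sub>R a) = c * val a"
  using val_pos_scaleR[of c a] val_pos_scaleR[of "- c" a] val_minus[of "c *\<^sub>R a"]
  by (cases c "0::real" rule: linorder_cases) (auto simp: val_zero)

lemma linear_val: "linear val"
  by (rule linearI) (simp_all add: val_add val_scaleR)

lemma val_nonneg: "a \<in> M \<Longrightarrow> 0 \<le> val a"
  using le_val[of a 0] by simp

text \<open>Products of elements of \<open>M\<close> are not known to be in \<open>M\<close>, but
  \<open>(e + a)^2 (e - a) + (e - a)^2 (e + a) = 2 e (e^2 - a^2)\<close> only multiplies by squares.
  It turns the bounds \<open>- e\<close> and \<open>e\<close> for \<open>a\<close>, in the order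
  given by \<open>M\<close>, into the bound \<open>e^2\<close> for \<open>a^2\<close>.\<close>

lemma val_square_zero:
  assumes "val a = 0" shows "val (a\<^sup>2) = 0"
proof -
  have "val (a\<^sup>2) \<le> 0 + d" if d: "0 < d" for d
  proof -
    define e where "e = sqrt d"
    have e: "0 < e" "e\<^sup>2 = d" using d by (auto simp: e_def)
    have m: "e *\<^sub>R 1 - a \<in> M" "e *\<^sub>R 1 + a \<in> M"
      using e assms mem_upper[of a e] mem_lower[of "- e" a] by (auto simp: add.commute)
    have "(e *\<^sub>R 1 + a)\<^sup>2 * (e *\<^sub>R 1 - a) + (e *\<^sub>R 1 - a)\<^sup>2 * (e *\<^sub>R 1 + a) \<in> M"
      by (intro add square_mult m)
    moreover have "(e *\<^sub>R 1 + a)\<^sup>2 * (e *\<^sub>R 1 - a) + (e *\<^sub>R 1 - a)\<^sup>2 * (e *\<^sub>R 1 + a)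
        = ((e *\<^sub>R 1)\<^sup>2 - a\<^sup>2) * (e *\<^sub>R 1) + ((e *\<^sub>R 1)\<^sup>2 - a\<^sup>2) * (e *\<^sub>R 1)"
      by (simp add: power2_eq_square algebra_simps)
    moreover have "\<dots> = (2 * e) *\<^sub>R (d *\<^sub>R 1 - a\<^sup>2)"
      unfolding e(2)[symmetric] scaleR_2[symmetric] by (simp add: power2_eq_square)
    ultimately have "0 \<le> (2 * e) * (d - val (a\<^sup>2))"
      using val_nonneg val_scaleR val_add[of "d *\<^sub>R 1" "- a\<^sup>2"] val_minus val_const
      by (metis diff_conv_add_uminus)
    then show ?thesis using e by (simp add: zero_le_mult_iff)
  qed
  then have "val (a\<^sup>2) \<le> 0" by (rule field_le_epsilon)
  with val_nonneg[OF square, of a] show ?thesis by simp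
qed

text \<open>The square of \<open>a - val a\<close> has value 0 by \<open>val_square_zero\<close>;
  expanding it gives the claim.\<close>

lemma val_square: "val (a\<^sup>2) = (val a)\<^sup>2"
proof -
  let ?b = "a + (- val a) *\<^sub>R 1"
  have "val ?b = 0" by (simp add: val_add val_scaleR val_const[of 1, simplified] del: scaleR_minus_left)
  then have "val (?b\<^sup>2) = 0" by (rule val_square_zero)
  moreover have "?b\<^sup>2 = a\<^sup>2 + ((- 2 * val a) *\<^sub>R a + ((val a)\<^sup>2) *\<^sub>R 1)"
    by (simp add: power2_eq_square algebra_simps flip: scaleR_add_left)
  ultimately show ?thesis
    by (simp add: val_add val_scaleR val_const[of 1, simplified] power2_eq_square del: scaleR_minus_left)
qed

lemma val_mult: "val (a * b) = val a * val b"
proof -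
  have "a * b = (1/4) *\<^sub>R ((a + b)\<^sup>2 + - ((a + - b)\<^sup>2))"
    by (intro scaleR_quarter) (simp add: power2_eq_square algebra_simps)
  then have "val (a * b) = (1/4) * ((val a + val b)\<^sup>2 - (val a - val b)\<^sup>2)"
    by (simp only: val_scaleR val_add val_minus val_square) simp
  then show ?thesis by (simp add: power2_eq_square algebra_simps)
qed

lemma val_in_nonneg_characters: "val \<in> nonneg_characters M"
  using linear_val val_const[of 1] val_mult val_nonneg
  by (auto simp: nonneg_characters_def character_space_def)

end

text \<open>A maximal proper quadratic module above \<open>Q\<close> inherits the Archimedean
  property, so its \<open>val\<close> is a character that is nonnegative on
  \<open>Q\<close>.\<close>

theorem nonneg_characters_nonempty:
  assumes "archimedean_quadratic_module Q" "- 1 \<notin> Q"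
  shows "nonneg_characters Q \<noteq> {}"
proof -
  have Q: "quadratic_module Q" using assms by (simp add: archimedean_quadratic_module_def)
  obtain M where M: "quadratic_module M" "Q \<subseteq> M" "- 1 \<notin> M"
    "\<And>N. quadratic_module N \<Longrightarrow> M \<subseteq> N \<Longrightarrow> - 1 \<notin> N \<Longrightarrow> N = M"
    by (rule maximal_quadratic_module_exists[OF Q assms(2)]) blast
  interpret maximal_archimedean M
  proof
    show "\<exists>N::nat. of_nat N + a \<in> M \<and> of_nat N - a \<in> M" for a
      using assms(1) M(2) unfolding archimedean_quadratic_module_def by blast
  qed (fact M)+
  show ?thesis
    using val_in_nonneg_characters M(2) by (auto simp: nonneg_characters_def)
qed

section \<open>States with bounded moments\<close>

text \<open>If \<open>y < x\<close>, the powers of \<open>x / y\<close> eventually exceed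
  \<open>C\<close>. The exponents are powers of 2 because these arise from iterating the
  Cauchy--Schwarz inequality. Multiplicative constants are removed from the growth estimates below
  in this way.\<close>

lemma le_of_power_le_const_mult:
  fixes x y C :: real
  assumes "0 \<le> x" "0 \<le> y" and le: "\<And>k. x ^ (2 ^ Suc k) \<le> C * y ^ (2 ^ Suc k)"
  shows "x \<le> y"
proof (rule ccontr)
  assume "\<not> x \<le> y"
  then have xy: "y < x" by simp
  show False
  proof (cases "y = 0")
    case True
    then show False using le[of 0] xy by simp
  next
    case False
    then have y: "0 < y" using assms by simp
    obtain n where n: "C < (x / y) ^ n" using real_arch_pow[of "x / y" C] xy y by auto
    have "n \<le> 2 ^ Suc n" using less_exp[of n] unfolding power_Suc by linarith
    then have "(x / y) ^ n \<le> (x / y) ^ (2 ^ Suc n)"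
      using xy y by (intro power_increasing) (auto simp: field_simps)
    also have "\<dots> \<le> C"
      using le[of n] y unfolding power_divide by (simp add: divide_le_eq del: power_Suc)
    finally show False using n by simp
  qed
qed

locale algebra_state =
  fixes L :: "'a::{real_algebra_1, comm_ring_1} \<Rightarrow> real"
  assumes linear: "linear L"
    and normalized: "L 1 = 1"
    and square_nonneg: "0 \<le> L (a\<^sup>2)"
begin

lemmas L_add = linear_add[OF linear]
  and L_diff = linear_diff[OF linear]
  and L_neg = linear_neg[OF linear]
  and L_scale = linear_scale[OF linear]

lemma const: "L (c *\<^sub>R 1) = c"
  by (simp add: L_scale normalized)

lemma even_power_nonneg: "even n \<Longrightarrow> 0 \<le> L (a ^ n)"
  using square_nonneg by (auto elim!: evenE simp: power_mult power2_eq_square power_mult_distrib mult.commute[of 2])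

text \<open>\<open>L ((t a + b)^2)\<close> is a nonnegative quadratic polynomial in
  \<open>t\<close>.\<close>

lemma Cauchy_Schwarz: "(L (a * b))\<^sup>2 \<le> L (a\<^sup>2) * L (b\<^sup>2)"
proof -
  have *: "0 \<le> t\<^sup>2 * L (a\<^sup>2) + 2 * t * L (a * b) + L (b\<^sup>2)" for t
  proof -
    have "L ((t *\<^sub>R a + b)\<^sup>2) = t\<^sup>2 * L (a\<^sup>2) + 2 * t * L (a * b) + L (b\<^sup>2)"
      by (simp add: power2_eq_square distrib_left distrib_right L_add L_scale mult.commute[of b a])
    then show ?thesis using square_nonneg[of "t *\<^sub>R a + b"] by simp
  qed
  show ?thesis
  proof (cases "L (a\<^sup>2) = 0")
    case True
    have "L (a * b) = 0"
    proof (rule ccontr)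
      assume "L (a * b) \<noteq> 0"
      then show False
        \<comment> \<open>The leading coefficient is 0 here, and at this \<open>t\<close> the
          polynomial would take the value -1.\<close>
        using *[of "- (L (b\<^sup>2) + 1) / (2 * L (a * b))"] True by (simp add: field_simps)
    qed
    then show ?thesis using True by simp
  next
    case False
    then have "0 < L (a\<^sup>2)" using square_nonneg[of a] by simp
    then show ?thesis
      \<comment> \<open>The point where the polynomial is minimal.\<close>
      using *[of "- L (a * b) / L (a\<^sup>2)"]
      by (simp add: power2_eq_square field_simps)
  qed
qed

lemma square_le: "(L a)\<^sup>2 \<le> L (a\<^sup>2)"
  using Cauchy_Schwarz[of a 1] normalized by simp

lemma abs_power_le: "\<bar>L a\<bar> ^ (2 ^ Suc k) \<le> L (a ^ (2 ^ Suc k))"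
proof (induction k)
  case 0
  then show ?case using square_le by simp
next
  case (Suc k)
  have "\<bar>L a\<bar> ^ (2 ^ Suc (Suc k)) = (\<bar>L a\<bar> ^ (2 ^ Suc k))\<^sup>2"
    by (simp add: power_mult[symmetric] mult.commute)
  also have "\<dots> \<le> (L (a ^ (2 ^ Suc k)))\<^sup>2"
    using Suc by (intro power_mono) auto
  also have "\<dots> \<le> L ((a ^ (2 ^ Suc k))\<^sup>2)" by (rule square_le)
  also have "(a ^ (2 ^ Suc k))\<^sup>2 = a ^ (2 ^ Suc (Suc k))"
    by (simp add: power_mult[symmetric] mult.commute)
  finally show ?case .
qed

text \<open>The hypothesis is used at the exponents \<open>2 * n * 2^(k+1)\<close>. By
  \<open>abs_power_le\<close> these moments dominate powers of the moment of order
  \<open>2 * n\<close>, and \<open>C\<close> drops out by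
  \<open>le_of_power_le_const_mult\<close>.\<close>

lemma moment_le:
  assumes r: "0 \<le> r" and le: "\<And>n. 1 \<le> n \<Longrightarrow> L (a ^ (2 * n)) \<le> C * r ^ (2 * n)" and n: "1 \<le> n"
  shows "L (a ^ (2 * n)) \<le> r ^ (2 * n)"
proof (rule le_of_power_le_const_mult)
  show "0 \<le> L (a ^ (2 * n))" by (rule even_power_nonneg) simp
  then have "L (a ^ (2 * n)) ^ (2 ^ Suc k) \<le> L ((a ^ (2 * n)) ^ (2 ^ Suc k))" for k
    using abs_power_le[of "a ^ (2 * n)" k] by simp
  also have "L ((a ^ (2 * n)) ^ (2 ^ Suc k)) = L (a ^ (2 * (n * 2 ^ Suc k)))" for k
    by (simp only: power_mult[symmetric] mult.assoc)
  also have "\<dots> k \<le> C * r ^ (2 * (n * 2 ^ Suc k))" for k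
    using n by (intro le) simp
  also have "C * r ^ (2 * (n * 2 ^ Suc k)) = C * (r ^ (2 * n)) ^ (2 ^ Suc k)" for k
    by (simp only: power_mult[symmetric] mult.assoc)
  finally show "L (a ^ (2 * n)) ^ (2 ^ Suc k) \<le> C * (r ^ (2 * n)) ^ (2 ^ Suc k)" for k .
qed (use r in simp)

lemma moment_growth_le:
  assumes r: "0 \<le> r" and le: "\<And>n. 1 \<le> n \<Longrightarrow> L (a ^ (2 * n)) \<le> C * r ^ (2 * n)"
  shows "moment_growth L a \<le> ereal r"
  unfolding moment_growth_def
proof (rule SUP_least)
  fix n :: nat assume "n \<in> {1..}"
  then have n: "1 \<le> n" by simp
  have "root (2 * n) (L (a ^ (2 * n))) \<le> root (2 * n) (r ^ (2 * n))"
    using moment_le[OF r le n] n by (intro real_root_le_mono) auto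
  also have "\<dots> = r" using r n by (simp add: real_root_power_cancel)
  finally show "ereal (root (2 * n) (L (a ^ (2 * n)))) \<le> ereal r" by simp
qed

lemma moment_growth_nonneg: "0 \<le> moment_growth L a"
proof -
  have "(0::ereal) \<le> ereal (root (2 * 1) (L (a ^ (2 * 1))))"
    using even_power_nonneg[of "2 * 1" a] by simp
  also have "\<dots> \<le> moment_growth L a"
    unfolding moment_growth_def by (intro SUP_upper) auto
  finally show ?thesis .
qed

text \<open>Continuity at the powers of \<open>a\<close> gives the bound
  \<open>C * p a ^ (2 * n)\<close> for the moments, and \<open>moment_growth_le\<close> removes
  \<open>C\<close>. The lemma is applied to \<open>L\<close> and, later, to single
  characters.\<close>

lemma moment_growth_le_of_submultiplicative:
  assumes p: "submultiplicative_seminorm p" and cont: "seminorm_continuous p L"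
  shows "moment_growth L a \<le> ereal (p a)"
proof -
  obtain C where C: "0 < C" "\<And>a. \<bar>L a\<bar> \<le> C * p a" using cont by (auto simp: seminorm_continuous_def)
  \<comment> \<open>The induction starts at exponent 1, since \<open>p 1\<close> may exceed
    1.\<close>
  have pow: "p (a ^ Suc n) \<le> p a ^ Suc n" for n
  proof (induction n)
    case (Suc n)
    have "p (a ^ Suc (Suc n)) \<le> p a * p (a ^ Suc n)"
      using p by (simp add: submultiplicative_seminorm_def)
    also have "\<dots> \<le> p a * p a ^ Suc n"
      using p by (intro mult_left_mono Suc) (simp add: submultiplicative_seminorm_def)
    finally show ?case by simp
  qed simp
  show ?thesis
  proof (rule moment_growth_le)
    show "0 \<le> p a" using p by (simp add: submultiplicative_seminorm_def)
    fix n :: nat assume "1 \<le> n"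
    then have "p (a ^ (2 * n)) \<le> p a ^ (2 * n)"
      using pow[of "2 * n - 1"] by simp
    then show "L (a ^ (2 * n)) \<le> C * p a ^ (2 * n)"
      using C(2)[of "a ^ (2 * n)"] C(1) by (meson abs_le_D1 mult_le_cancel_left_pos order_trans)
  qed
qed

text \<open>The identity behind \<open>val_square_zero\<close> puts a positive multiple of
  \<open>c^2 - a^2\<close> into \<open>Q\<close>. After multiplication by \<open>a^(2n)\<close> it
  shows that two more factors \<open>a\<close> enlarge a moment at most by the factor
  \<open>c^2\<close>.\<close>

lemma moment_growth_finite_of_archimedean:
  assumes Q: "archimedean_quadratic_module Q" and pos: "positive_on L Q"
  shows "moment_growth L a < \<infinity>"
proof -
  have qm: "quadratic_module Q" using Q by (simp add: archimedean_quadratic_module_def)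
  obtain N :: nat where N: "1 \<le> N" "of_nat N + a \<in> Q" "of_nat N - a \<in> Q"
    using Q unfolding archimedean_quadratic_module_def by blast
  define c where "c = real N"
  have c: "0 < c" "c *\<^sub>R 1 + a \<in> Q" "c *\<^sub>R 1 - a \<in> Q"
    using N unfolding c_def of_nat_eq_scaleR[where 'a = 'a] by auto
  have "(c *\<^sub>R 1 + a)\<^sup>2 * (c *\<^sub>R 1 - a) + (c *\<^sub>R 1 - a)\<^sup>2 * (c *\<^sub>R 1 + a) \<in> Q"
    by (intro quadratic_module_add[OF qm] quadratic_module_square_mult[OF qm] c)
  also have "(c *\<^sub>R 1 + a)\<^sup>2 * (c *\<^sub>R 1 - a) + (c *\<^sub>R 1 - a)\<^sup>2 * (c *\<^sub>R 1 + a)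
      = ((c *\<^sub>R 1)\<^sup>2 - a\<^sup>2) * (c *\<^sub>R 1) + ((c *\<^sub>R 1)\<^sup>2 - a\<^sup>2) * (c *\<^sub>R 1)"
    by (simp add: power2_eq_square algebra_simps)
  also have "\<dots> = (2 * c) *\<^sub>R (c\<^sup>2 *\<^sub>R 1 - a\<^sup>2)"
    unfolding scaleR_2[symmetric] by (simp add: power2_eq_square)
  finally have q: "(2 * c) *\<^sub>R (c\<^sup>2 *\<^sub>R 1 - a\<^sup>2) \<in> Q" .
  have step: "L (a ^ (2 * Suc n)) \<le> c\<^sup>2 * L (a ^ (2 * n))" for n
  proof -
    have "(a ^ n)\<^sup>2 * ((2 * c) *\<^sub>R (c\<^sup>2 *\<^sub>R 1 - a\<^sup>2)) \<in> Q"
      by (rule quadratic_module_square_mult[OF qm q])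
    moreover have "(a ^ n)\<^sup>2 * ((2 * c) *\<^sub>R (c\<^sup>2 *\<^sub>R 1 - a\<^sup>2))
        = (2 * c) *\<^sub>R (c\<^sup>2 *\<^sub>R a ^ (2 * n) - a ^ (2 * Suc n))"
      by (simp add: power2_eq_square power_mult_distrib power_mult algebra_simps)
    ultimately have "0 \<le> (2 * c) * (c\<^sup>2 * L (a ^ (2 * n)) - L (a ^ (2 * Suc n)))"
      using pos unfolding positive_on_def by (metis L_diff L_scale real_scaleR_def)
    then show ?thesis using c by (simp add: zero_le_mult_iff)
  qed
  have "L (a ^ (2 * n)) \<le> c ^ (2 * n)" for n
  proof (induction n)
    case 0
    then show ?case by (simp add: normalized)
  next
    case (Suc n)
    have "L (a ^ (2 * Suc n)) \<le> c\<^sup>2 * c ^ (2 * n)"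
      using step[of n] mult_left_mono[OF Suc, of "c\<^sup>2"] by simp
    then show ?case by (simp add: power2_eq_square)
  qed
  then have "moment_growth L a \<le> ereal c"
    using c by (intro moment_growth_le[where C = 1]) auto
  then show ?thesis by (auto intro: le_less_trans)
qed

text \<open>For \<open>q\<close> in \<open>Q\<close> all \<open>b^2 q\<close> are in
  \<open>Q\<close> as well. This is the maximality of the moment quadratic module.\<close>

lemma positive_on_imp_subset:
  assumes "quadratic_module Q" "positive_on L Q"
  shows "Q \<subseteq> moment_quadratic_module L"
  using assms quadratic_module_square_mult[OF assms(1)]
  by (auto simp: moment_quadratic_module_def positive_on_def)

lemma quadratic_module_moment: "quadratic_module (moment_quadratic_module L)"
  unfolding quadratic_module_def
proof (intro conjI ballI allI)
  show "1 \<in> moment_quadratic_module L"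
    by (simp add: moment_quadratic_module_def square_nonneg)
  show "q + r \<in> moment_quadratic_module L"
    if "q \<in> moment_quadratic_module L" "r \<in> moment_quadratic_module L" for q r
    using that by (simp add: moment_quadratic_module_def distrib_left L_add)
  show "a\<^sup>2 * q \<in> moment_quadratic_module L" if "q \<in> moment_quadratic_module L" for a q
    unfolding moment_quadratic_module_def
  proof (intro CollectI allI)
    fix b
    have "0 \<le> L ((b * a)\<^sup>2 * q)" using that unfolding moment_quadratic_module_def by blast
    then show "0 \<le> L (b\<^sup>2 * (a\<^sup>2 * q))" by (simp add: power_mult_distrib mult.assoc)
  qed
qed

lemma positive_on_moment: "positive_on L (moment_quadratic_module L)"
proof -
  have "0 \<le> L (1\<^sup>2 * q)" if "q \<in> moment_quadratic_module L" for q
    using that unfolding moment_quadratic_module_def by blast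
  then show ?thesis by (simp add: positive_on_def)
qed

end

section \<open>The moment seminorm and the moment quadratic module\<close>

locale bounded_state = algebra_state +
  assumes bounded: "moment_growth L a < \<infinity>"
begin

abbreviation "p \<equiv> moment_seminorm L"
abbreviation "Q \<equiv> moment_quadratic_module L"
abbreviation "K \<equiv> nonneg_characters Q"

text \<open>Both infinities are excluded, so the default value of \<open>real_of_ereal\<close> does
  not occur.\<close>

lemma moment_growth_eq: "moment_growth L a = ereal (p a)"
  using bounded[of a] moment_growth_nonneg[of a]
  unfolding moment_seminorm_def by (cases "moment_growth L a") auto

lemma p_nonneg: "0 \<le> p a"
  using moment_growth_nonneg[of a] by (simp add: moment_growth_eq)

lemma moment_le_p: "L (a ^ (2 * n)) \<le> p a ^ (2 * n)"
proof (cases "n = 0")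
  case False
  have nn: "0 \<le> L (a ^ (2 * n))" by (rule even_power_nonneg) simp
  have "ereal (root (2 * n) (L (a ^ (2 * n)))) \<le> ereal (p a)"
    unfolding moment_growth_eq[symmetric] moment_growth_def using False by (intro SUP_upper) auto
  then have "root (2 * n) (L (a ^ (2 * n))) ^ (2 * n) \<le> p a ^ (2 * n)"
    using nn False by (intro power_mono) (auto intro: real_root_ge_zero)
  then show ?thesis using nn False by (simp add: real_root_pow_pos2)
qed (simp add: normalized)

lemma p_le:
  assumes "0 \<le> r" "\<And>n. 1 \<le> n \<Longrightarrow> L (a ^ (2 * n)) \<le> C * r ^ (2 * n)"
  shows "p a \<le> r"
  using moment_growth_le[OF assms] by (simp add: moment_growth_eq)

lemma abs_le_p: "\<bar>L a\<bar> \<le> p a"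
proof -
  have "\<bar>L a\<bar>\<^sup>2 \<le> (p a)\<^sup>2"
    using square_le[of a] moment_le_p[of a 1] by simp
  then show ?thesis using p_nonneg by (simp add: power2_le_iff_abs_le)
qed

text \<open>The estimate of \<open>abs_power_le\<close>, applied to the state \<open>x \<mapsto> L (b\<^sup>2 x) / L (b\<^sup>2)\<close>.\<close>

lemma abs_square_mult_le: "\<bar>L (b\<^sup>2 * a)\<bar> \<le> L (b\<^sup>2) * p a"
proof (cases "L (b\<^sup>2) = 0")
  case True
  then have "(L (b * (b * a)))\<^sup>2 \<le> 0" using Cauchy_Schwarz[of b "b * a"] by simp
  then have "L (b * (b * a)) = 0" by simp
  then have "L (b\<^sup>2 * a) = 0" by (simp add: power2_eq_square mult.assoc)
  then show ?thesis using True by simp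
next
  case False
  define B where "B = L (b\<^sup>2)"
  have B: "0 < B" using False square_nonneg[of b] by (simp add: B_def)
  define l where "l = (\<lambda>x. L (b\<^sup>2 * x) / B)"
  interpret l: algebra_state l
  proof (rule algebra_state.intro)
    show "linear l"
      by (rule linearI) (simp_all add: l_def distrib_left L_add L_scale add_divide_distrib)
    show "l 1 = 1" using B by (simp add: l_def B_def)
    show "0 \<le> l (a\<^sup>2)" for a
      using square_nonneg[of "b * a"] B by (simp add: l_def power_mult_distrib)
  qed
  \<comment> \<open>Cauchy--Schwarz separates \<open>b^2\<close> from the powers of
    \<open>a\<close>; \<open>D\<close> is the part coming from \<open>b\<close>, and it does not
    depend on the exponent.\<close>
  define D where "D = sqrt (L (b ^ 4)) / B"
  have "\<bar>l a\<bar> \<le> p a"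
  proof (rule le_of_power_le_const_mult)
    fix k
    let ?n = "2 ^ Suc k :: nat"
    have "\<bar>L (b\<^sup>2 * a ^ ?n)\<bar> \<le> sqrt (L ((b\<^sup>2)\<^sup>2) * L ((a ^ ?n)\<^sup>2))"
      by (rule real_le_rsqrt) (simp only: power2_abs Cauchy_Schwarz)
    also have "\<dots> \<le> sqrt (L (b ^ 4)) * p a ^ ?n"
    proof -
      have "L ((a ^ ?n)\<^sup>2) \<le> (p a ^ ?n)\<^sup>2"
        using moment_le_p[of a ?n] by (simp only: power_mult[symmetric] mult.commute[of 2])
      then have "sqrt (L ((a ^ ?n)\<^sup>2)) \<le> p a ^ ?n"
        by (intro real_le_lsqrt) (auto simp: p_nonneg square_nonneg)
      then show ?thesis
        using even_power_nonneg[of 4 b]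
        by (simp add: real_sqrt_mult mult_left_mono del: power_Suc flip: power_mult)
    qed
    finally have "l (a ^ ?n) \<le> D * p a ^ ?n"
      using B by (simp add: l_def D_def divide_right_mono)
    then show "\<bar>l a\<bar> ^ ?n \<le> D * p a ^ ?n"
      using l.abs_power_le[of a k] by simp
  qed (auto simp: p_nonneg)
  then show ?thesis using B by (simp add: l_def B_def field_simps)
qed

lemma generators_in_Q: "p a *\<^sub>R 1 + a \<in> Q" "p a *\<^sub>R 1 - a \<in> Q"
proof -
  have "0 \<le> L (b\<^sup>2 * (p a *\<^sub>R 1 + a))" "0 \<le> L (b\<^sup>2 * (p a *\<^sub>R 1 - a))" for b
    using abs_square_mult_le[of b a]
    by (simp_all add: abs_le_iff distrib_left right_diff_distrib L_add L_diff L_scale mult.commute)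
  then show "p a *\<^sub>R 1 + a \<in> Q" "p a *\<^sub>R 1 - a \<in> Q"
    by (auto simp: moment_quadratic_module_def)
qed

lemma archimedean_Q: "archimedean_quadratic_module Q"
  unfolding archimedean_quadratic_module_def
proof (intro conjI allI quadratic_module_moment)
  fix a
  obtain N :: nat where N: "max 1 (p a) \<le> real N" using real_arch_simple by blast
  note gen = generators_in_Q[of a]
  have "(real N - p a) *\<^sub>R 1 + (p a *\<^sub>R 1 + a) \<in> Q" "(real N - p a) *\<^sub>R 1 + (p a *\<^sub>R 1 - a) \<in> Q"
    using N gen
    by (auto intro!: quadratic_module_add[OF quadratic_module_moment] quadratic_module_const[OF quadratic_module_moment])
  then show "\<exists>N. 1 \<le> N \<and> of_nat N + a \<in> Q \<and> of_nat N - a \<in> Q"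
    using N by (intro exI[of _ N]) (simp add: of_nat_eq_scaleR[where 'a = 'a] algebra_simps)
qed

lemma K_le_p: "\<alpha> \<in> K \<Longrightarrow> \<bar>\<alpha> a\<bar> \<le> p a"
proof -
  assume a: "\<alpha> \<in> K"
  then have l: "linear \<alpha>" "\<alpha> 1 = 1" by (auto simp: nonneg_characters_def character_space_def)
  have "0 \<le> \<alpha> (p a *\<^sub>R 1 + a)" "0 \<le> \<alpha> (p a *\<^sub>R 1 - a)"
    using a generators_in_Q[of a] by (auto simp: nonneg_characters_def)
  then show ?thesis using l by (simp add: linear_add linear_diff linear_scale abs_le_iff)
qed

text \<open>If \<open>-1 = q + (a\<^sup>2 - r\<^sup>2) s\<close> with \<open>q \<in> Q\<close> and \<open>s\<close> a sum of squares, then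
  \<open>u\<^sub>n = L (a\<^sup>2\<^sup>n s)\<close> satisfies \<open>u\<^sub>n\<^sub>+\<^sub>1 \<le> r\<^sup>2 u\<^sub>n - L (a\<^sup>2\<^sup>n)\<close>,
  whence \<open>L (a\<^sup>2\<^sup>n) = O(r\<^sup>2\<^sup>n)\<close>.\<close>

lemma exists_character_gt:
  assumes r: "0 \<le> r" "r < p a"
  obtains \<alpha> where "\<alpha> \<in> K" "r \<le> \<bar>\<alpha> a\<bar>"
proof -
  let ?c = "a\<^sup>2 - r\<^sup>2 *\<^sub>R 1"
  let ?R = "adjoin Q ?c"
  note R = quadratic_module_adjoin[OF quadratic_module_moment, of ?c]
  have "- 1 \<notin> ?R"
  proof
    assume "- 1 \<in> ?R"
    then obtain q s where qs: "- 1 = q + ?c * s" "q \<in> Q" "s \<in> sums_of_squares"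
      by (auto simp: adjoin_def)
    define u where "u = (\<lambda>n. L (a ^ (2 * n) * s))"
    have sQ: "s \<in> Q" using qs(3) sums_of_squares_subset[OF quadratic_module_moment] by auto
    have pos: "0 \<le> L (a ^ (2 * n) * x)" if "x \<in> Q" for x n
    proof -
      have "0 \<le> L ((a ^ n)\<^sup>2 * x)" using that unfolding moment_quadratic_module_def by blast
      then show ?thesis by (simp only: power_mult[symmetric] mult.commute[of n 2])
    qed
    have u: "u (Suc n) + L (a ^ (2 * n)) \<le> r\<^sup>2 * u n" for n
    proof -
      have "a ^ (2 * n) * (- 1) = a ^ (2 * n) * q + (a ^ (2 * Suc n) * s - r\<^sup>2 *\<^sub>R (a ^ (2 * n) * s))"
        unfolding qs(1) by (simp add: power2_eq_square algebra_simps)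
      then have "L (a ^ (2 * n) * (- 1)) = L (a ^ (2 * n) * q) + (u (Suc n) - r\<^sup>2 * u n)"
        by (simp only: L_add L_diff L_scale u_def real_scaleR_def)
      then show ?thesis using pos[OF qs(2), of n] by (simp add: L_neg)
    qed
    have uu: "u n \<le> r ^ (2 * n) * u 0" for n
    proof (induction n)
      case (Suc n)
      have "u (Suc n) \<le> r\<^sup>2 * u n"
        using u[of n] even_power_nonneg[of "2 * n" a] by simp
      also have "\<dots> \<le> r\<^sup>2 * (r ^ (2 * n) * u 0)" by (intro mult_left_mono Suc) simp
      finally show ?case by (simp add: power2_eq_square mult.assoc)
    qed simp
    have "p a \<le> r"
    proof (rule p_le[OF r(1)])
      fix n :: nat
      have "L (a ^ (2 * n)) \<le> r\<^sup>2 * u n" using u[of n] pos[OF sQ, of "Suc n"] by (simp add: u_def)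
      also have "\<dots> \<le> r\<^sup>2 * (r ^ (2 * n) * u 0)" by (intro mult_left_mono uu) simp
      finally show "L (a ^ (2 * n)) \<le> (r\<^sup>2 * u 0) * r ^ (2 * n)" by (simp add: mult_ac)
    qed
    then show False using r by simp
  qed
  moreover have "archimedean_quadratic_module ?R"
    using archimedean_Q R unfolding archimedean_quadratic_module_def by blast
  ultimately obtain \<alpha> where \<alpha>: "\<alpha> \<in> nonneg_characters ?R"
    using nonneg_characters_nonempty[of ?R] by auto
  then have "\<alpha> \<in> K" using R(2) by (auto simp: nonneg_characters_def)
  moreover have "0 \<le> \<alpha> ?c" using \<alpha> R(3) by (auto simp: nonneg_characters_def)
  then have "r\<^sup>2 \<le> (\<alpha> a)\<^sup>2"
    using \<alpha> by (auto simp: nonneg_characters_def character_space_def linear_diff linear_scale power2_eq_square)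
  then have "r \<le> \<bar>\<alpha> a\<bar>" using r by (simp add: abs_le_square_iff[symmetric])
  ultimately show thesis by (rule that)
qed

lemma p_one: "p 1 = 1"
proof (rule antisym)
  show "p 1 \<le> 1" by (rule p_le[where C = 1]) (simp_all add: normalized)
  show "1 \<le> p 1" using abs_le_p[of 1] by (simp add: normalized)
qed

lemma K_nonempty: "K \<noteq> {}"
  using exists_character_gt[of 0 1] by (auto simp: p_one)

text \<open>Together with \<open>K_le_p\<close> this makes \<open>p\<close> the supremum norm over
  \<open>K\<close>. A gap between \<open>c\<close> and \<open>p a\<close> would contain a level
  \<open>r\<close> that some character in \<open>K\<close> reaches.\<close>

lemma p_le_of_K:
  assumes "\<And>\<alpha>. \<alpha> \<in> K \<Longrightarrow> \<bar>\<alpha> a\<bar> \<le> c" shows "p a \<le> c"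
proof (rule ccontr)
  assume "\<not> p a \<le> c"
  moreover have "0 \<le> c" using K_nonempty assms by (meson abs_ge_zero all_not_in_conv order_trans)
  ultimately obtain r where r: "c < r" "0 \<le> r" "r < p a"
    using dense[of c "p a"] by auto
  obtain \<alpha> where "\<alpha> \<in> K" "r \<le> \<bar>\<alpha> a\<bar>" by (rule exists_character_gt[OF r(2,3)])
  then show False using assms r by fastforce
qed

lemma characterD:
  assumes "\<alpha> \<in> K"
  shows "linear \<alpha>" "\<alpha> 1 = 1" "\<alpha> (a * b) = \<alpha> a * \<alpha> b" "\<alpha> (a + b) = \<alpha> a + \<alpha> b"
    "\<alpha> (a - b) = \<alpha> a - \<alpha> b" "\<alpha> (c *\<^sub>R a) = c * \<alpha> a"
  using assms by (auto simp: nonneg_characters_def character_space_def linear_add linear_diff linear_scale)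

lemma submultiplicative_p: "submultiplicative_seminorm p"
  unfolding submultiplicative_seminorm_def
proof (intro conjI allI p_nonneg)
  have le: "p (c *\<^sub>R a) \<le> \<bar>c\<bar> * p a" for c a
    by (rule p_le_of_K) (simp add: characterD abs_mult mult_left_mono K_le_p)
  show "p (c *\<^sub>R a) = \<bar>c\<bar> * p a" for c a
  proof (cases "c = 0")
    case True
    then show ?thesis using le[of 0 a] p_nonneg[of 0] by simp
  next
    case False
    \<comment> \<open>The reverse inequality is \<open>le\<close> for the inverse scalar.\<close>
    have "p (inverse c *\<^sub>R (c *\<^sub>R a)) \<le> \<bar>inverse c\<bar> * p (c *\<^sub>R a)" by (rule le)
    then have "\<bar>c\<bar> * p a \<le> p (c *\<^sub>R a)" using False by (simp add: field_simps)
    then show ?thesis using le[of c a] by simp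
  qed
  show "p (a + b) \<le> p a + p b" for a b
    by (rule p_le_of_K) (simp add: characterD abs_triangle_ineq[THEN order_trans] add_mono K_le_p)
  show "p (a * b) \<le> p a * p b" for a b
    by (rule p_le_of_K) (simp add: characterD abs_mult mult_mono K_le_p p_nonneg)
qed

lemma continuous_p: "seminorm_continuous p L"
  unfolding seminorm_continuous_def using abs_le_p by (intro exI[of _ 1]) simp

lemma p_le_seminorm:
  assumes "submultiplicative_seminorm q" "seminorm_continuous q L" shows "p a \<le> q a"
  using moment_growth_le_of_submultiplicative[OF assms, of a] by (simp add: moment_growth_eq)

section \<open>Generators of \<open>Q\<close> and descriptions of \<open>K\<close>\<close>

abbreviation "H \<equiv> quadratic_module hull
  (range (\<lambda>a. p a *\<^sub>R 1 + a) \<union> range (\<lambda>a. p a *\<^sub>R 1 - a))"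

lemma quadratic_module_H: "quadratic_module H"
  by (rule hull_in) (auto simp: quadratic_module_def)

lemma generators_in_H: "p a *\<^sub>R 1 + a \<in> H" "p a *\<^sub>R 1 - a \<in> H"
  by (intro hull_inc; simp)+

lemma H_subset_Q: "H \<subseteq> Q"
  using generators_in_Q quadratic_module_moment by (intro hull_minimal) auto

text \<open>An element with values in \<open>[0, c]\<close> on \<open>K\<close> differs from \<open>c / 2\<close> by at most \<open>c / 2\<close>.\<close>

lemma Pos_K_subset_H: "Pos K \<subseteq> H"
proof
  fix a assume a: "a \<in> Pos K"
  define c where "c = p a"
  define b where "b = a - (c / 2) *\<^sub>R 1"
  have "p b \<le> c / 2"
  proof (rule p_le_of_K)
    fix \<alpha> assume k: "\<alpha> \<in> K"
    have "0 \<le> \<alpha> a" using a k by (simp add: Pos_def)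
    moreover have "\<alpha> a \<le> c" using K_le_p[OF k, of a] by (simp add: c_def)
    moreover have "\<alpha> b = \<alpha> a - c / 2" using k by (simp add: b_def characterD)
    ultimately show "\<bar>\<alpha> b\<bar> \<le> c / 2" by (simp only: abs_le_iff) linarith
  qed
  then have "(c / 2 - p b) *\<^sub>R 1 + (p b *\<^sub>R 1 + b) \<in> H"
    by (intro quadratic_module_add quadratic_module_const quadratic_module_H generators_in_H) simp
  then show "a \<in> H" by (simp add: b_def algebra_simps)
qed

lemma Q_subset_Pos_K: "Q \<subseteq> Pos K"
  by (auto simp: Pos_def nonneg_characters_def)

text \<open>The inclusions close up in a circle: \<open>H\<close>, \<open>Q\<close>,
  \<open>Pos K\<close>, and back to \<open>H\<close>.\<close>

lemma Q_eq_H: "Q = H" and Q_eq_Pos_K: "Q = Pos K"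
  using H_subset_Q Pos_K_subset_H Q_subset_Pos_K by auto

lemma moment_characters_eq: "moment_characters L = {\<alpha> \<in> character_space. \<forall>a. \<bar>\<alpha> a\<bar> \<le> p a}"
  by (simp add: moment_characters_def moment_growth_eq)

text \<open>The bound by \<open>p\<close> says that \<open>\<alpha>\<close> is nonnegative on the
  generators of \<open>H\<close>. The elements with nonnegative value form a quadratic module, so
  \<open>\<alpha>\<close> is nonnegative on \<open>H = Q\<close>.\<close>

lemma moment_characters_eq_K: "moment_characters L = K"
proof
  show "K \<subseteq> moment_characters L"
    using K_le_p unfolding moment_characters_eq by (auto simp: nonneg_characters_def)
  show "moment_characters L \<subseteq> K"
  proof
    fix \<alpha> assume a: "\<alpha> \<in> moment_characters L"
    then have \<alpha>: "linear \<alpha>" "\<alpha> 1 = 1" "\<And>a b. \<alpha> (a * b) = \<alpha> a * \<alpha> b" "\<And>a. \<bar>\<alpha> a\<bar> \<le> p a"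
      "\<alpha> \<in> character_space"
      by (auto simp: moment_characters_eq character_space_def)
    have "H \<subseteq> {a. 0 \<le> \<alpha> a}"
    proof (rule hull_minimal)
      show "quadratic_module {a. 0 \<le> \<alpha> a}"
        by (auto simp: quadratic_module_def \<alpha> linear_add power2_eq_square)
      show "range (\<lambda>a. p a *\<^sub>R 1 + a) \<union> range (\<lambda>a. p a *\<^sub>R 1 - a) \<subseteq> {a. 0 \<le> \<alpha> a}"
      proof -
        have "0 \<le> \<alpha> (p a *\<^sub>R 1 + a)" "0 \<le> \<alpha> (p a *\<^sub>R 1 - a)" for a
          using \<alpha>(1,2) \<alpha>(4)[of a] by (simp_all add: linear_add linear_diff linear_scale abs_le_iff)
        then show ?thesis by auto
      qed
    qed
    then show "\<alpha> \<in> K" using \<alpha>(5) by (auto simp: nonneg_characters_def Q_eq_H)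
  qed
qed

text \<open>A character is itself an algebra state, whose moment growth at \<open>a\<close> is at
  least \<open>\<bar>\<alpha> a\<bar>\<close>. Continuity with respect to the submultiplicative
  \<open>p\<close> thus improves to the constant 1.\<close>

lemma gelfand_spectrum_eq_K: "gelfand_spectrum p = K"
proof
  show "K \<subseteq> gelfand_spectrum p"
    using K_le_p by (force simp: gelfand_spectrum_def seminorm_continuous_def nonneg_characters_def intro!: exI[of _ 1])
  show "gelfand_spectrum p \<subseteq> K"
  proof
    fix \<alpha> assume a: "\<alpha> \<in> gelfand_spectrum p"
    then have \<alpha>: "linear \<alpha>" "\<alpha> 1 = 1" "\<And>a b. \<alpha> (a * b) = \<alpha> a * \<alpha> b" "\<alpha> \<in> character_space"
      "seminorm_continuous p \<alpha>"
      by (auto simp: gelfand_spectrum_def character_space_def)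
    interpret \<alpha>: algebra_state \<alpha>
      by (rule algebra_state.intro) (simp_all add: \<alpha> power2_eq_square)
    have pow: "\<alpha> (a ^ n) = \<alpha> a ^ n" for a n by (induction n) (simp_all add: \<alpha>)
    have "\<bar>\<alpha> a\<bar> \<le> p a" for a
    proof -
      have "ereal (root (2 * 1) (\<alpha> (a ^ (2 * 1)))) \<le> moment_growth \<alpha> a"
        unfolding moment_growth_def by (intro SUP_upper) auto
      also have "\<dots> \<le> ereal (p a)"
        by (rule \<alpha>.moment_growth_le_of_submultiplicative[OF submultiplicative_p \<alpha>(5)])
      finally show ?thesis by (simp add: pow sqrt_def[symmetric])
    qed
    then show "\<alpha> \<in> K" using \<alpha>(4) unfolding moment_characters_eq_K[symmetric] moment_characters_eq by auto
  qed
qed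

end

section \<open>The character space\<close>

lemma topspace_character_topology [simp]: "topspace character_topology = character_space"
  unfolding character_topology_def by (auto intro!: exI[of _ UNIV])

text \<open>The weak topology of the evaluations is the trace of the product topology, so
  compactness and Borel sets can be handled in the Hausdorff space of all functions.\<close>

lemma character_topology_eq: "character_topology = top_of_set character_space"
  unfolding topology_eq
proof (intro allI iffI)
  fix S :: "('a \<Rightarrow> real) set"
  assume "openin character_topology S"
  then have "generate_topology_on {{\<alpha> \<in> character_space. \<alpha> a \<in> U} | a U. open U} S"
    by (simp add: character_topology_def openin_topology_generated_by_iff)
  then show "openin (top_of_set character_space) S"
  proof (rule generate_topology_on_coarsest[rotated 2])
    show "istopology (openin (top_of_set (character_space :: ('a \<Rightarrow> real) set)))" by simp
    fix V :: "('a \<Rightarrow> real) set"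
    assume "V \<in> {{\<alpha> \<in> character_space. \<alpha> a \<in> U} | a U. open U}"
    then obtain a U where V: "V = character_space \<inter> (\<lambda>\<alpha>. \<alpha> a) -` U" "open U" by auto
    have "open ((\<lambda>\<alpha> :: 'a \<Rightarrow> real. \<alpha> a) -` U)"
      using V by (auto intro!: open_vimage continuous_on_product_coordinates)
    then show "openin (top_of_set character_space) V" using V by auto
  qed
next
  fix S :: "('a \<Rightarrow> real) set"
  assume "openin (top_of_set character_space) S"
  then obtain T where T: "open T" "S = character_space \<inter> T" by (auto simp: openin_open)
  have "continuous_map character_topology (product_topology (\<lambda>_. euclidean) UNIV) (\<lambda>\<alpha> :: 'a \<Rightarrow> real. \<alpha>)"
    unfolding continuous_map_componentwise_UNIV
  proof
    fix a :: 'a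
    show "continuous_map character_topology euclideanreal (\<lambda>\<alpha>. \<alpha> a)"
      unfolding continuous_map_def
    proof (intro conjI allI impI)
      fix U :: "real set" assume "openin euclidean U"
      then show "openin character_topology {\<alpha> \<in> topspace character_topology. \<alpha> a \<in> U}"
        unfolding topspace_character_topology unfolding character_topology_def
        by (intro topology_generated_by_Basis) auto
    qed simp
  qed
  then have "openin character_topology {\<alpha> \<in> topspace character_topology. \<alpha> \<in> T}"
    using T(1) unfolding euclidean_product_topology continuous_map_def by simp
  then show "openin character_topology S" using T(2) by (simp add: Int_def)
qed

lemma compactin_character_topology:
  "compactin character_topology C \<longleftrightarrow> compact C \<and> C \<subseteq> character_space"
  by (simp add: character_topology_eq compactin_subtopology)

lemma continuous_on_eval: "continuous_on S (\<lambda>\<alpha> :: 'a \<Rightarrow> real. \<alpha> a)"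
  by (rule continuous_on_subset[OF continuous_on_product_coordinates]) simp

lemma closed_character_space: "closed (character_space :: ('a::{real_algebra_1, comm_ring_1} \<Rightarrow> real) set)"
  unfolding character_space_def linear_iff
  by (intro closed_Collect_conj closed_Collect_all closed_Collect_eq continuous_intros continuous_on_eval)

lemma character_space_borel:
  "(character_space :: ('a::{real_algebra_1, comm_ring_1} \<Rightarrow> real) set) \<in> sets borel"
  by (rule borel_closed[OF closed_character_space])

text \<open>The sigma-algebra generated by the traces of the open sets is the trace of the Borel
  sigma-algebra.\<close>

lemma sets_character_topology:
  "sigma_sets (topspace character_topology) {U. openin character_topology U}
    = sets (restrict_space borel (character_space :: ('a::{real_algebra_1, comm_ring_1} \<Rightarrow> real) set))"
proof -
  have "{U. openin character_topology U} = (\<inter>) (character_space :: ('a \<Rightarrow> real) set) ` {U. open U}"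
    by (auto simp: character_topology_eq openin_open)
  moreover have "character_space \<in> sigma_sets UNIV {U :: ('a \<Rightarrow> real) set. open U}"
    using character_space_borel unfolding sets_borel .
  ultimately show ?thesis
    by (simp add: sets_restrict_space sets_borel sigma_sets_Int)
qed

section \<open>Supports of Radon measures\<close>

text \<open>The support is the complement of the union of all open null sets. This union may be
  uncountable, but finitely many of the sets cover a given compact subset, so inner regularity makes
  it null. Hence \<open>LEAST\<close> denotes an actual least set.\<close>

lemma measure_support_properties:
  assumes "radon_measure X \<nu>"
  shows closedin_measure_support: "closedin X (measure_support X \<nu>)"
    and emeasure_Diff_measure_support: "emeasure \<nu> (topspace X - measure_support X \<nu>) = 0"
    and measure_support_subset: "\<And>C. closedin X C \<Longrightarrow> emeasure \<nu> (topspace X - C) = 0 \<Longrightarrow> measure_support X \<nu> \<subseteq> C"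
proof -
  let ?N = "{U. openin X U \<and> emeasure \<nu> U = 0}"
  let ?S = "topspace X - \<Union> ?N"
  have sets: "\<And>U. openin X U \<Longrightarrow> U \<in> sets \<nu>"
    using assms by (auto simp: radon_measure_def)
  have op: "openin X (\<Union> ?N)" by auto
  then have compl: "topspace X - ?S = \<Union> ?N"
    using openin_subset by blast
  have cl: "closedin X ?S" using op by blast
  have "emeasure \<nu> K = 0" if K: "compactin X K" "K \<subseteq> \<Union> ?N" for K
  proof -
    obtain \<F> where F: "finite \<F>" "\<F> \<subseteq> ?N" "K \<subseteq> \<Union> \<F>"
      using K compactinD[of X K ?N] by auto
    have "emeasure \<nu> K \<le> emeasure \<nu> (\<Union> \<F>)"
      using F sets by (intro emeasure_mono) (auto intro: sets.finite_Union)
    also have "\<dots> \<le> (\<Sum>U\<in>\<F>. emeasure \<nu> U)"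
      using emeasure_subadditive_finite[of \<F> "\<lambda>U. U" \<nu>] F sets by auto
    also have "\<dots> = 0" using F by (intro sum.neutral) auto
    finally show ?thesis by simp
  qed
  then have "(SUP K\<in>{K. compactin X K \<and> K \<subseteq> \<Union> ?N}. emeasure \<nu> K) \<le> 0"
    by (intro SUP_least) auto
  then have null: "emeasure \<nu> (topspace X - ?S) = 0"
    using assms sets[OF op] unfolding radon_measure_def compl by simp
  have least: "?S \<subseteq> C" if "closedin X C" "emeasure \<nu> (topspace X - C) = 0" for C
    using that by blast
  have "measure_support X \<nu> = ?S"
    unfolding measure_support_def by (rule Least_equality) (use cl null least in auto)
  then show "closedin X (measure_support X \<nu>)" "emeasure \<nu> (topspace X - measure_support X \<nu>) = 0"
    "\<And>C. closedin X C \<Longrightarrow> emeasure \<nu> (topspace X - C) = 0 \<Longrightarrow> measure_support X \<nu> \<subseteq> C"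
    using cl null least by auto
qed

section \<open>The compact set of characters of a bounded state\<close>

context bounded_state
begin

lemma K_subset: "K \<subseteq> character_space"
  by (auto simp: nonneg_characters_def)

text \<open>By Tychonoff's theorem: \<open>K\<close> is a closed part of the product of the
  intervals from \<open>- p a\<close> to \<open>p a\<close>.\<close>

lemma compact_K: "compact K"
proof -
  have "compact (\<Pi>\<^sub>E a\<in>UNIV. {- p a..p a})"
    using compactin_PiE[of "\<lambda>_. euclidean" UNIV "\<lambda>a. {- p a..p a}"]
    by (simp add: euclidean_product_topology)
  moreover have "K = (\<Pi>\<^sub>E a\<in>UNIV. {- p a..p a}) \<inter> character_space"
    unfolding moment_characters_eq_K[symmetric] moment_characters_eq by (auto simp: PiE_iff abs_le_iff) (metis minus_le_iff)+
  ultimately show ?thesis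
    using compact_Int_closed closed_character_space by metis
qed

text \<open>Stone--Weierstrass: the evaluations form an algebra on \<open>K\<close>, as characters
  are multiplicative, and distinct characters differ at some element. The ring only asks for
  agreement with an evaluation on \<open>K\<close>, because arbitrary functions are not
  multiplicative.\<close>

lemma approximation:
  fixes f :: "('a \<Rightarrow> real) \<Rightarrow> real"
  assumes "continuous_on K f" "0 < e"
  obtains a where "\<And>\<alpha>. \<alpha> \<in> K \<Longrightarrow> \<bar>f \<alpha> - \<alpha> a\<bar> < e"
proof -
  interpret function_ring_on "{f. \<exists>a. \<forall>\<alpha>\<in>K. f \<alpha> = \<alpha> a} \<inter> {f. continuous_on K f}" K
  proof
    fix f g :: "('a \<Rightarrow> real) \<Rightarrow> real"
    let ?R = "{f. \<exists>a. \<forall>\<alpha>\<in>K. f \<alpha> = \<alpha> a} \<inter> {f. continuous_on K f}"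
    assume fg: "f \<in> ?R" "g \<in> ?R"
    then have "continuous_on K f" "continuous_on K g" by simp_all
    moreover obtain a b where "\<forall>\<alpha>\<in>K. f \<alpha> = \<alpha> a" "\<forall>\<alpha>\<in>K. g \<alpha> = \<alpha> b"
      using fg by blast
    ultimately show "(\<lambda>x. f x + g x) \<in> ?R" "(\<lambda>x. f x * g x) \<in> ?R"
      by (simp_all add: continuous_on_add continuous_on_mult)
        (metis characterD(4), metis characterD(3))
  next
    fix c
    show "(\<lambda>_. c) \<in> {f. \<exists>a. \<forall>\<alpha>\<in>K. f \<alpha> = \<alpha> a} \<inter> {f. continuous_on K f}"
      by (auto intro!: exI[of _ "c *\<^sub>R 1"] simp: characterD)
  next
    fix \<alpha> \<beta> :: "'a \<Rightarrow> real" assume "\<alpha> \<noteq> \<beta>"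
    then obtain a where "\<alpha> a \<noteq> \<beta> a" by auto
    then show "\<exists>f\<in>{f. \<exists>a. \<forall>\<alpha>\<in>K. f \<alpha> = \<alpha> a} \<inter> {f. continuous_on K f}. f \<alpha> \<noteq> f \<beta>"
      by (intro bexI[of _ "\<lambda>\<alpha>. \<alpha> a"]) (auto intro: continuous_on_eval)
  qed (auto simp: compact_K)
  obtain g a where "\<forall>\<alpha>\<in>K. g \<alpha> = \<alpha> a" "\<forall>\<alpha>\<in>K. \<bar>f \<alpha> - g \<alpha>\<bar> < e"
    using Stone_Weierstrass_basic[OF assms] by auto
  then show thesis by (intro that[of a]) auto
qed

section \<open>Extension of \<open>L\<close> to the continuous functions on \<open>K\<close>\<close>

lemma L_le:
  assumes "\<And>\<alpha>. \<alpha> \<in> K \<Longrightarrow> \<alpha> a \<le> \<alpha> b + c" shows "L a \<le> L b + c"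
proof -
  have "b + c *\<^sub>R 1 - a \<in> Q"
    using assms by (subst Q_eq_Pos_K) (simp add: Pos_def characterD)
  then have "0 \<le> L (b + c *\<^sub>R 1 - a)" using positive_on_moment unfolding positive_on_def by blast
  then show ?thesis by (simp add: L_add L_diff const)
qed

text \<open>An infimum over dominating evaluations needs no choice of approximating sequences. For
  continuous \<open>f\<close> uniform approximation makes it linear.\<close>

definition upper_extension :: "(('a \<Rightarrow> real) \<Rightarrow> real) \<Rightarrow> real" where
  "upper_extension f = Inf {L a | a. \<forall>\<alpha>\<in>K. f \<alpha> \<le> \<alpha> a}"

text \<open>\<open>a + e\<close> dominates \<open>f\<close> on \<open>K\<close>, and every
  dominating \<open>b\<close> satisfies \<open>\<alpha> a \<le> \<alpha> b + e\<close> there, so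
  \<open>L_le\<close> bounds the infimum from below.\<close>

lemma upper_extension_approx:
  assumes "\<And>\<alpha>. \<alpha> \<in> K \<Longrightarrow> \<bar>f \<alpha> - \<alpha> a\<bar> \<le> e"
  shows "\<bar>upper_extension f - L a\<bar> \<le> e"
proof -
  let ?A = "{L a | a. \<forall>\<alpha>\<in>K. f \<alpha> \<le> \<alpha> a}"
  have low: "L a - e \<le> x" if x: "x \<in> ?A" for x
  proof -
    obtain b where b: "x = L b" "\<forall>\<alpha>\<in>K. f \<alpha> \<le> \<alpha> b" using x by auto
    have "L a \<le> L b + e"
    proof (rule L_le)
      show "\<alpha> a \<le> \<alpha> b + e" if "\<alpha> \<in> K" for \<alpha>
        using assms[OF that] b(2) that by fastforce
    qed
    then show ?thesis using b by simp
  qed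
  have "f \<alpha> \<le> \<alpha> (a + e *\<^sub>R 1)" if "\<alpha> \<in> K" for \<alpha>
    using assms[OF that] that by (simp add: characterD)
  then have mem: "L (a + e *\<^sub>R 1) \<in> ?A" by blast
  have "upper_extension f \<le> L (a + e *\<^sub>R 1)"
    unfolding upper_extension_def using mem low by (intro cInf_lower bdd_belowI[of _ "L a - e"]) auto
  moreover have "L a - e \<le> upper_extension f"
    unfolding upper_extension_def using mem low by (intro cInf_greatest) auto
  ultimately show ?thesis by (simp add: L_add const abs_le_iff)
qed

lemma upper_extension_eval: "upper_extension (\<lambda>\<alpha>. \<alpha> a) = L a"
  using upper_extension_approx[of "\<lambda>\<alpha>. \<alpha> a" a 0] by simp

text \<open>Each law is transferred from \<open>L\<close> at approximating elements, up to an
  arbitrary error \<open>e\<close>.\<close>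

lemma positive_functional_upper_extension: "positive_functional K upper_extension"
proof
  show "compact K" by (rule compact_K)
next
  fix f g :: "('a \<Rightarrow> real) \<Rightarrow> real"
  assume f: "continuous_on K f" and g: "continuous_on K g"
  have "\<bar>upper_extension (\<lambda>x. f x + g x) - (upper_extension f + upper_extension g)\<bar> \<le> 0"
  proof (rule field_le_epsilon)
    fix e :: real assume "0 < e"
    then have e: "0 < e / 4" by simp
    obtain a where a: "\<And>\<alpha>. \<alpha> \<in> K \<Longrightarrow> \<bar>f \<alpha> - \<alpha> a\<bar> < e / 4" by (rule approximation[OF f e]) blast
    obtain b where b: "\<And>\<alpha>. \<alpha> \<in> K \<Longrightarrow> \<bar>g \<alpha> - \<alpha> b\<bar> < e / 4" by (rule approximation[OF g e]) blast
    have "\<bar>(f \<alpha> + g \<alpha>) - \<alpha> (a + b)\<bar> \<le> e / 2" if "\<alpha> \<in> K" for \<alpha>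
      using a[OF that] b[OF that] characterD(4)[OF that, of a b] by linarith
    then have "\<bar>upper_extension (\<lambda>x. f x + g x) - L (a + b)\<bar> \<le> e / 2"
      by (rule upper_extension_approx)
    moreover have "\<bar>upper_extension f - L a\<bar> \<le> e / 4" "\<bar>upper_extension g - L b\<bar> \<le> e / 4"
      by (rule upper_extension_approx, rule less_imp_le, erule a b)+
    ultimately show "\<bar>upper_extension (\<lambda>x. f x + g x) - (upper_extension f + upper_extension g)\<bar> \<le> 0 + e"
      using L_add[of a b] by linarith
  qed
  then show "upper_extension (\<lambda>x. f x + g x) = upper_extension f + upper_extension g" by simp
next
  fix f :: "('a \<Rightarrow> real) \<Rightarrow> real" and c :: real
  assume f: "continuous_on K f"
  have "\<bar>upper_extension (\<lambda>x. c * f x) - c * upper_extension f\<bar> \<le> 0"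
  proof (rule field_le_epsilon)
    fix e :: real assume e: "0 < e"
    \<comment> \<open>Two errors \<open>\<bar>c\<bar> * d\<close> must fit into \<open>e\<close>;
      the summand 1 allows for \<open>c = 0\<close>.\<close>
    define d where "d = e / (2 * (\<bar>c\<bar> + 1))"
    have d: "0 < d" "2 * (\<bar>c\<bar> * d) \<le> e" using e by (auto simp: d_def field_simps)
    obtain a where a: "\<And>\<alpha>. \<alpha> \<in> K \<Longrightarrow> \<bar>f \<alpha> - \<alpha> a\<bar> < d" by (rule approximation[OF f d(1)]) blast
    have "\<bar>c * f \<alpha> - \<alpha> (c *\<^sub>R a)\<bar> \<le> \<bar>c\<bar> * d" if "\<alpha> \<in> K" for \<alpha>
      using mult_left_mono[OF less_imp_le[OF a[OF that]], of "\<bar>c\<bar>"] that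
      by (simp add: characterD right_diff_distrib flip: abs_mult)
    then have "\<bar>upper_extension (\<lambda>x. c * f x) - L (c *\<^sub>R a)\<bar> \<le> \<bar>c\<bar> * d"
      by (rule upper_extension_approx)
    moreover have "\<bar>upper_extension f - L a\<bar> \<le> d"
      by (intro upper_extension_approx less_imp_le[OF a])
    then have "\<bar>c * upper_extension f - c * L a\<bar> \<le> \<bar>c\<bar> * d"
      using mult_left_mono[of "\<bar>upper_extension f - L a\<bar>" d "\<bar>c\<bar>"]
      by (simp add: right_diff_distrib flip: abs_mult)
    ultimately show "\<bar>upper_extension (\<lambda>x. c * f x) - c * upper_extension f\<bar> \<le> 0 + e"
      using d(2) by (simp add: L_scale)
  qed
  then show "upper_extension (\<lambda>x. c * f x) = c * upper_extension f" by simp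
next
  fix f g :: "('a \<Rightarrow> real) \<Rightarrow> real"
  assume f: "continuous_on K f" and g: "continuous_on K g" and le: "\<And>x. x \<in> K \<Longrightarrow> f x \<le> g x"
  show "upper_extension f \<le> upper_extension g"
  proof (rule field_le_epsilon)
    fix e :: real assume "0 < e"
    then have e: "0 < e / 4" by simp
    obtain a where a: "\<And>\<alpha>. \<alpha> \<in> K \<Longrightarrow> \<bar>f \<alpha> - \<alpha> a\<bar> < e / 4" by (rule approximation[OF f e]) blast
    obtain b where b: "\<And>\<alpha>. \<alpha> \<in> K \<Longrightarrow> \<bar>g \<alpha> - \<alpha> b\<bar> < e / 4" by (rule approximation[OF g e]) blast
    have "L a \<le> L b + e / 2"
    proof (rule L_le)
      show "\<alpha> a \<le> \<alpha> b + e / 2" if "\<alpha> \<in> K" for \<alpha>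
        using a[OF that] b[OF that] le[OF that] by linarith
    qed
    moreover have "\<bar>upper_extension f - L a\<bar> \<le> e / 4" "\<bar>upper_extension g - L b\<bar> \<le> e / 4"
      by (rule upper_extension_approx, rule less_imp_le, erule a b)+
    ultimately show "upper_extension f \<le> upper_extension g + e" by linarith
  qed
qed

section \<open>Existence of a representing measure\<close>

sublocale riesz: positive_functional K upper_extension
  by (rule positive_functional_upper_extension)

text \<open>The Riesz measure lives on all functions, whereas a Radon measure on the character space
  must have that space as its carrier. No mass is lost, as \<open>K\<close> consists of
  characters.\<close>

definition representing_measure :: "('a \<Rightarrow> real) measure" where
  "representing_measure = restrict_space riesz.riesz_measure character_space"

lemma space_representing_measure: "space representing_measure = character_space"
  by (simp add: representing_measure_def space_restrict_space)

lemma sets_representing_measure: "sets representing_measure = sets (restrict_space borel character_space)"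
  unfolding representing_measure_def by (rule sets_restrict_space_cong) simp

lemma emeasure_representing_measure:
  assumes "B \<subseteq> character_space"
  shows "emeasure representing_measure B = emeasure riesz.riesz_measure B"
  unfolding representing_measure_def using assms character_space_borel
  by (intro emeasure_restrict_space) auto

lemma radon_representing_measure: "radon_measure character_topology representing_measure"
  unfolding radon_measure_def
proof (intro conjI ballI)
  let ?M = riesz.riesz_measure
  show "space representing_measure = topspace character_topology"
    by (simp add: space_representing_measure)
  show "sets representing_measure = sigma_sets (topspace character_topology) {U. openin character_topology U}"
    by (simp only: sets_representing_measure sets_character_topology)
  show "\<exists>U. openin character_topology U \<and> x \<in> U \<and> emeasure representing_measure U < \<infinity>"
    if "x \<in> topspace character_topology" for x
    using that by (intro exI[of _ character_space])
      (auto simp: emeasure_representing_measure character_topology_eq less_top[symmetric])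
  fix B assume "B \<in> sets representing_measure"
  then have B: "B \<subseteq> character_space" "B \<in> sets borel"
    using character_space_borel[where 'a = 'a] sets_restrict_space_iff[of character_space borel B]
    by (simp_all add: sets_representing_measure)
  show "emeasure representing_measure B
    = (SUP C\<in>{C. compactin character_topology C \<and> C \<subseteq> B}. emeasure representing_measure C)"
  proof (rule antisym)
    show "(SUP C\<in>{C. compactin character_topology C \<and> C \<subseteq> B}. emeasure representing_measure C)
        \<le> emeasure representing_measure B"
      using \<open>B \<in> sets representing_measure\<close> by (intro SUP_least emeasure_mono) auto
    show "emeasure representing_measure B
        \<le> (SUP C\<in>{C. compactin character_topology C \<and> C \<subseteq> B}. emeasure representing_measure C)"
    proof (rule ennreal_le_epsilon)
      fix e :: real assume e: "0 < e"
      obtain C where C: "compact C" "C \<subseteq> B" "emeasure ?M B \<le> emeasure ?M C + ennreal e"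
        by (rule riesz.riesz_measure_inner_regular[OF B(2) e])
      have "emeasure representing_measure B \<le> emeasure representing_measure C + ennreal e"
        using B C by (subst (1 2) emeasure_representing_measure) auto
      also have "\<dots> \<le> (SUP C\<in>{C. compactin character_topology C \<and> C \<subseteq> B}. emeasure representing_measure C) + ennreal e"
        using B C by (intro add_right_mono SUP_upper) (auto simp: compactin_character_topology)
      finally show "emeasure representing_measure B
        \<le> (SUP C\<in>{C. compactin character_topology C \<and> C \<subseteq> B}. emeasure representing_measure C) + ennreal e" .
    qed
  qed
qed

lemma representing_representing_measure: "representing_radon_measure L representing_measure"
  unfolding representing_radon_measure_def
proof (intro conjI allI radon_representing_measure)
  fix a
  let ?M = riesz.riesz_measure
  \<comment> \<open>The two integrands differ only on the complement of \<open>K\<close>, a null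
    set.\<close>
  have AE: "AE \<alpha> in ?M. indicator K \<alpha> *\<^sub>R \<alpha> a = indicator character_space \<alpha> *\<^sub>R \<alpha> a"
    using riesz.closed_K riesz.emeasure_riesz_measure_Compl K_subset
    by (intro AE_I[of _ _ "- K"]) (auto simp: indicator_def)
  have meas: "(\<lambda>\<alpha>. indicator character_space \<alpha> *\<^sub>R \<alpha> a) \<in> borel_measurable ?M"
    using borel_measurable_continuous_on_indicator[OF character_space_borel continuous_on_eval[of character_space a]]
    by (simp cong: measurable_cong_sets)
  have int: "integrable ?M (\<lambda>\<alpha>. indicator K \<alpha> *\<^sub>R \<alpha> a)"
    using riesz.set_integrable_riesz[OF continuous_on_eval] by (simp add: set_integrable_def)
  then have "integrable ?M (\<lambda>\<alpha>. indicator character_space \<alpha> *\<^sub>R \<alpha> a)"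
    by (rule integrable_cong_AE_imp[OF _ meas]) (use AE in auto)
  then show "integrable representing_measure (\<lambda>\<alpha>. \<alpha> a)"
    unfolding representing_measure_def using character_space_borel
    by (subst integrable_restrict_space) auto
  have "L a = (LINT \<alpha>:K|?M. \<alpha> a)"
    using riesz.set_integral_riesz[OF continuous_on_eval] upper_extension_eval by simp
  also have "\<dots> = (\<integral>\<alpha>. indicator character_space \<alpha> *\<^sub>R \<alpha> a \<partial>?M)"
    unfolding set_lebesgue_integral_def
    by (rule integral_cong_AE) (use int meas AE in auto)
  also have "\<dots> = (\<integral>\<alpha>. \<alpha> a \<partial>representing_measure)"
    unfolding representing_measure_def using character_space_borel
    by (subst integral_restrict_space) auto
  finally show "L a = (\<integral>\<alpha>. \<alpha> a \<partial>representing_measure)" .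
qed

lemma compact_support_representing_measure:
  "compactin character_topology (measure_support character_topology representing_measure)"
proof (rule closed_compactin)
  show "compactin character_topology K"
    using compact_K K_subset by (simp add: compactin_character_topology)
  show "closedin character_topology (measure_support character_topology representing_measure)"
    by (rule closedin_measure_support[OF radon_representing_measure])
  show "measure_support character_topology representing_measure \<subseteq> K"
  proof (rule measure_support_subset[OF radon_representing_measure])
    show "closedin character_topology K"
      using riesz.closed_K K_subset by (auto simp: character_topology_eq closed_subset)
    have "emeasure representing_measure (character_space - K) \<le> emeasure riesz.riesz_measure (- K)"
      using riesz.closed_K by (subst emeasure_representing_measure) (auto intro!: emeasure_mono)
    then show "emeasure representing_measure (topspace character_topology - K) = 0"
      by (simp add: riesz.emeasure_riesz_measure_Compl)
  qed
qed

end

section \<open>Representing measures with compact support\<close>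

locale representation = algebra_state L
  for L :: "'a::{real_algebra_1, comm_ring_1} \<Rightarrow> real" +
  fixes \<nu> :: "('a \<Rightarrow> real) measure"
  assumes rep: "representing_radon_measure L \<nu>"
    and compact_support: "compactin character_topology (measure_support character_topology \<nu>)"
begin

abbreviation "S \<equiv> measure_support character_topology \<nu>"

lemma radon: "radon_measure character_topology \<nu>"
  using rep by (simp add: representing_radon_measure_def)

lemma integrable_eval: "integrable \<nu> (\<lambda>\<alpha>. \<alpha> a)" and integral_eval: "(\<integral>\<alpha>. \<alpha> a \<partial>\<nu>) = L a"
  using rep by (auto simp: representing_radon_measure_def)

lemma space_\<nu>: "space \<nu> = character_space"
  using radon by (simp add: radon_measure_def)

lemma sets_\<nu>: "sets \<nu> = sets (restrict_space borel character_space)"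
  using radon by (simp only: radon_measure_def sets_character_topology)

lemma borel_sets_\<nu>: "B \<in> sets borel \<Longrightarrow> B \<subseteq> character_space \<Longrightarrow> B \<in> sets \<nu>"
  unfolding sets_\<nu> using character_space_borel by (subst sets_restrict_space_iff) auto

lemma inner_regular:
  "B \<in> sets \<nu> \<Longrightarrow> emeasure \<nu> B = (SUP C\<in>{C. compactin character_topology C \<and> C \<subseteq> B}. emeasure \<nu> C)"
  using radon by (simp add: radon_measure_def)

sublocale finite_measure \<nu>
proof
  \<comment> \<open>Characters take the value 1 at 1, so integrability of that evaluation means
    finite total mass.\<close>
  have "integrable \<nu> (\<lambda>_. 1 :: real) \<longleftrightarrow> integrable \<nu> (\<lambda>\<alpha>. \<alpha> 1)"
    by (rule Bochner_Integration.integrable_cong) (auto simp: space_\<nu> character_space_def)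
  then show "emeasure \<nu> (space \<nu>) \<noteq> \<infinity>"
    using integrable_eval[of 1] by (simp add: integrable_iff_bounded)
qed

lemma measure_space_1: "measure \<nu> (space \<nu>) = 1"
proof -
  have "(\<integral>\<alpha>. 1 \<partial>\<nu>) = (\<integral>\<alpha>. \<alpha> 1 \<partial>\<nu>)"
    by (rule Bochner_Integration.integral_cong) (auto simp: space_\<nu> character_space_def)
  then show ?thesis by (simp add: integral_eval normalized)
qed

lemma compact_S: "compact S" and S_subset: "S \<subseteq> character_space"
  using compact_support by (auto simp: compactin_character_topology)

lemma AE_S: "AE \<alpha> in \<nu>. \<alpha> \<in> S"
  using emeasure_Diff_measure_support[OF radon] compact_S S_subset
  by (intro AE_I[of _ _ "character_space - S"]) (auto simp: space_\<nu> intro!: borel_sets_\<nu> sets.Diff character_space_borel borel_compact)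

lemma eval_power: "\<alpha> \<in> character_space \<Longrightarrow> \<alpha> (a ^ n) = \<alpha> a ^ n"
  by (induction n) (auto simp: character_space_def)

lemma moment_le_of_support:
  assumes "\<And>\<alpha>. \<alpha> \<in> S \<Longrightarrow> \<bar>\<alpha> a\<bar> \<le> c"
  shows "L (a ^ (2 * n)) \<le> c ^ (2 * n)"
proof -
  have "(\<integral>\<alpha>. \<alpha> (a ^ (2 * n)) \<partial>\<nu>) \<le> (\<integral>\<alpha>. c ^ (2 * n) \<partial>\<nu>)"
  proof (rule integral_mono_AE[OF integrable_eval])
    show "AE \<alpha> in \<nu>. \<alpha> (a ^ (2 * n)) \<le> c ^ (2 * n)"
      using AE_S
    proof eventually_elim
      case (elim \<alpha>)
      have "\<alpha> (a ^ (2 * n)) = \<bar>\<alpha> a\<bar> ^ (2 * n)"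
        using elim S_subset by (subst eval_power) (auto simp: power_even_abs)
      also have "\<dots> \<le> c ^ (2 * n)" using assms[OF elim] by (intro power_mono) auto
      finally show ?case .
    qed
  qed simp
  then show ?thesis by (simp add: integral_eval measure_space_1)
qed

text \<open>Evaluations are bounded on the compact support, and the total mass is 1.\<close>

lemma bounded_growth: "moment_growth L a < \<infinity>"
proof -
  have "compact ((\<lambda>\<alpha>. \<alpha> a) ` S)"
    by (intro compact_continuous_image continuous_on_eval compact_S)
  then obtain B where B: "\<And>\<alpha>. \<alpha> \<in> S \<Longrightarrow> \<bar>\<alpha> a\<bar> \<le> B"
    by (metis compact_imp_bounded bounded_iff image_eqI real_norm_def)
  have "moment_growth L a \<le> ereal \<bar>B\<bar>"
  proof (rule moment_growth_le[where C = 1])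
    show "L (a ^ (2 * n)) \<le> 1 * \<bar>B\<bar> ^ (2 * n)" for n
      using moment_le_of_support[of a "\<bar>B\<bar>" n] B by fastforce
  qed simp
  then show ?thesis by (auto intro: le_less_trans)
qed

sublocale bounded_state
  by standard (rule bounded_growth)

section \<open>Identification of the support\<close>

lemma p_le_of_S:
  assumes "0 \<le> c" "\<And>\<alpha>. \<alpha> \<in> S \<Longrightarrow> \<bar>\<alpha> a\<bar> \<le> c" shows "p a \<le> c"
  using moment_le_of_support[OF assms(2)] by (intro p_le[where C = 1] assms) auto

text \<open>An open set meeting the support has positive mass. If
  \<open>r < \<bar>\<alpha> a\<bar>\<close> at a point of the support, then the mass of the set
  where this holds, times \<open>r^n\<close>, is at most \<open>L (a^n) \<le> p a^n\<close> for the
  exponents \<open>n = 2^(k+1)\<close>. The mass is a constant factor and drops out, leaving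
  \<open>r \<le> p a\<close>.\<close>

lemma S_le_p:
  assumes \<alpha>: "\<alpha> \<in> S" shows "\<bar>\<alpha> a\<bar> \<le> p a"
proof (rule ccontr)
  assume "\<not> \<bar>\<alpha> a\<bar> \<le> p a"
  then obtain r where r: "p a < r" "r < \<bar>\<alpha> a\<bar>" using dense[of "p a" "\<bar>\<alpha> a\<bar>"] by auto
  have r0: "0 < r" using r p_nonneg[of a] by simp
  define U where "U = character_space \<inter> {\<beta>. r < \<bar>\<beta> a\<bar>}"
  have op: "open {\<beta> :: 'a \<Rightarrow> real. r < \<bar>\<beta> a\<bar>}"
    by (intro open_Collect_less continuous_intros continuous_on_eval)
  then have openU: "openin character_topology U" by (auto simp: U_def character_topology_eq)
  have U: "U \<in> sets \<nu>"
    using op unfolding U_def by (intro borel_sets_\<nu> sets.Int character_space_borel borel_open) auto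
  have "measure \<nu> U \<noteq> 0"
  proof
    assume "measure \<nu> U = 0"
    then have 0: "emeasure \<nu> U = 0" by (simp add: emeasure_eq_measure)
    have "topspace character_topology - (topspace character_topology - U) = U"
      using openin_subset[OF openU] by auto
    then have "S \<subseteq> topspace character_topology - U"
      using 0 by (intro measure_support_subset[OF radon] closedin_diff[OF closedin_topspace openU]) simp
    then show False using \<alpha> r S_subset by (auto simp: U_def)
  qed
  then have m: "0 < measure \<nu> U" by (simp add: zero_less_measure_iff)
  have "r \<le> p a"
  proof (rule le_of_power_le_const_mult)
    fix k
    let ?n = "2 ^ Suc k :: nat"
    have "r ^ ?n * measure \<nu> U = (\<integral>\<beta>. r ^ ?n * indicator U \<beta> \<partial>\<nu>)"
      using U by (simp add: emeasure_eq_measure)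
    also have "\<dots> \<le> (\<integral>\<beta>. \<beta> (a ^ ?n) \<partial>\<nu>)"
    proof (rule integral_mono[OF _ integrable_eval])
      show "integrable \<nu> (\<lambda>\<beta>. r ^ ?n * indicator U \<beta>)"
        using U by (simp add: emeasure_eq_measure)
      fix \<beta> assume "\<beta> \<in> space \<nu>"
      then have *: "\<beta> (a ^ ?n) = \<bar>\<beta> a\<bar> ^ ?n"
        by (subst eval_power) (auto simp: space_\<nu> power_even_abs)
      show "r ^ ?n * indicator U \<beta> \<le> \<beta> (a ^ ?n)"
        unfolding * using r0 by (auto simp: U_def indicator_def intro!: power_mono simp del: power_Suc)
    qed
    also have "\<dots> \<le> p a ^ ?n"
      using moment_le_p[of a "2 ^ k"] by (simp add: integral_eval)
    finally show "r ^ ?n \<le> (1 / measure \<nu> U) * p a ^ ?n"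
      using m by (simp add: field_simps del: power_Suc)
  qed (use r0 p_nonneg in auto)
  then show False using r by simp
qed

text \<open>A point of \<open>K\<close> outside \<open>S\<close> would be separated from
  \<open>S\<close> by a continuous function, hence by an element \<open>a\<close>. But
  \<open>p a\<close> is at most the supremum over \<open>S\<close> and also bounds the value at that
  point.\<close>

lemma S_eq_K: "S = K"
proof
  show "S \<subseteq> K"
    using S_le_p S_subset unfolding moment_characters_eq_K[symmetric] moment_characters_eq by auto
  show "K \<subseteq> S"
  proof
    fix \<alpha> assume \<alpha>: "\<alpha> \<in> K"
    show "\<alpha> \<in> S"
    proof (rule ccontr)
      assume "\<alpha> \<notin> S"
      then obtain h :: "('a \<Rightarrow> real) \<Rightarrow> real" where h: "continuous_on K h" "\<forall>x\<in>K \<inter> S. h x = 0" "\<forall>x\<in>K \<inter> {\<alpha>}. h x = 1"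
        using Urysohn_compact[OF compact_K compact_imp_closed[OF compact_S] closed_singleton[of \<alpha>]] by auto
      \<comment> \<open>Tolerance 1/3 keeps \<open>a\<close> within 1/3 of 0 on \<open>S\<close> and
        above 2/3 at \<open>\<alpha>\<close>.\<close>
      obtain a where a: "\<And>\<beta>. \<beta> \<in> K \<Longrightarrow> \<bar>h \<beta> - \<beta> a\<bar> < 1 / 3"
        by (rule approximation[OF h(1), of "1/3"]) auto
      have "p a \<le> 1 / 3"
      proof (rule p_le_of_S)
        fix \<beta> assume "\<beta> \<in> S"
        then show "\<bar>\<beta> a\<bar> \<le> 1 / 3" using a[of \<beta>] h(2) \<open>S \<subseteq> K\<close> by auto
      qed simp
      moreover have "h \<alpha> = 1" using h(3) \<alpha> by simp
      then have "2 / 3 < \<bar>\<alpha> a\<bar>" using a[OF \<alpha>] by linarith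
      ultimately show False using K_le_p[OF \<alpha>, of a] by simp
    qed
  qed
qed

text \<open>On the nonempty compact set \<open>S\<close> the supremum is attained, so
  \<open>GREATEST\<close> denotes a true maximum.\<close>

lemma max_seminorm_eq_p: "max_seminorm S = p"
proof
  fix a
  have "compact S" "S \<noteq> {}" "continuous_on S (\<lambda>\<alpha>. \<bar>\<alpha> a\<bar>)"
    using compact_S K_nonempty S_eq_K by (auto intro!: continuous_intros continuous_on_eval)
  then obtain \<alpha> where \<alpha>: "\<alpha> \<in> S" "\<And>\<beta>. \<beta> \<in> S \<Longrightarrow> \<bar>\<beta> a\<bar> \<le> \<bar>\<alpha> a\<bar>"
    using continuous_attains_sup by metis
  have "p a = \<bar>\<alpha> a\<bar>"
    using p_le_of_S[of "\<bar>\<alpha> a\<bar>" a] \<alpha> S_le_p[OF \<alpha>(1), of a] by simp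
  then show "max_seminorm S a = p a"
    unfolding max_seminorm_def using \<alpha> by (intro Greatest_equality) auto
qed

text \<open>A continuous function separating \<open>C\<close> from a compact set that nearly exhausts its complement
  is uniformly approximated by elements of the algebra, on which the two integrals agree.\<close>

lemma measure_compact_le:
  assumes "representation L \<mu>" and C: "compact C" "C \<subseteq> character_space"
  shows "measure \<nu> C \<le> measure \<mu> C"
proof (rule field_le_epsilon)
  interpret \<mu>: representation L \<mu> by fact
  have Cs: "C \<in> sets \<nu>" "C \<in> sets \<mu>"
    using C by (auto intro!: borel_sets_\<nu> \<mu>.borel_sets_\<nu> borel_compact)
  fix e :: real assume "0 < e"
  then have e: "0 < e / 3" by simp
  let ?D = "character_space - C"
  have Ds: "?D \<in> sets \<mu>" using Cs(2) \<mu>.space_\<nu> by (metis sets.compl_sets)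
  have "emeasure \<mu> ?D = (SUP D\<in>{D. compactin character_topology D \<and> D \<subseteq> ?D}. emeasure \<mu> D)"
    by (rule \<mu>.inner_regular[OF Ds])
  then have "emeasure \<mu> ?D < (SUP D\<in>{D. compactin character_topology D \<and> D \<subseteq> ?D}. emeasure \<mu> D + ennreal (e / 3))"
    using e \<mu>.emeasure_finite[of ?D] compactin_empty[of character_topology]
    by (subst ennreal_SUP_add_left) (auto simp: \<mu>.emeasure_eq_measure ennreal_less_iff simp flip: ennreal_plus)
  then obtain D where D: "compactin character_topology D" "D \<subseteq> ?D"
    "emeasure \<mu> ?D < emeasure \<mu> D + ennreal (e / 3)"
    unfolding less_SUP_iff by auto
  have D': "compact D" "D \<subseteq> character_space" using D by (auto simp: compactin_character_topology)
  have Dsets: "D \<in> sets \<mu>" using D' by (auto intro!: \<mu>.borel_sets_\<nu> borel_compact)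
  have "measure \<mu> ?D < measure \<mu> D + e / 3"
    using D(3) e by (simp add: \<mu>.emeasure_eq_measure ennreal_less_iff flip: ennreal_plus)
  then have D3: "1 - measure \<mu> D < measure \<mu> C + e / 3"
    using \<mu>.finite_measure_compl[OF Cs(2)] \<mu>.measure_space_1 by (simp add: \<mu>.space_\<nu>)
  obtain h :: "('a \<Rightarrow> real) \<Rightarrow> real" where h: "continuous_on K h" "\<forall>x\<in>K. 0 \<le> h x \<and> h x \<le> 1"
    "\<forall>x\<in>K \<inter> D. h x = 0" "\<forall>x\<in>K \<inter> C. h x = 1"
    using Urysohn_compact[OF compact_K compact_imp_closed[OF D'(1)] compact_imp_closed[OF C(1)]] D(2) by auto
  obtain a where a: "\<And>\<alpha>. \<alpha> \<in> K \<Longrightarrow> \<bar>h \<alpha> - \<alpha> a\<bar> < e / 3"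
    by (rule approximation[OF h(1) e]) blast
  have "measure \<nu> C = (\<integral>\<alpha>. indicator C \<alpha> \<partial>\<nu>)" using Cs by simp
  also have "\<dots> \<le> (\<integral>\<alpha>. \<alpha> a + e / 3 \<partial>\<nu>)"
  proof (rule integral_mono_AE)
    show "AE \<alpha> in \<nu>. indicator C \<alpha> \<le> \<alpha> a + e / 3"
      using AE_S unfolding S_eq_K
    proof eventually_elim
      case (elim \<alpha>)
      then have "indicator C \<alpha> \<le> h \<alpha>" using h(2,4) by (auto simp: indicator_def)
      then show ?case using a[OF elim] by linarith
    qed
  qed (use Cs integrable_eval in \<open>auto simp: emeasure_eq_measure\<close>)
  also have "\<dots> = L a + e / 3"
    using integrable_eval by (simp add: integral_eval measure_space_1)
  also have "L a = (\<integral>\<alpha>. \<alpha> a \<partial>\<mu>)" by (simp add: \<mu>.integral_eval)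
  also have "\<dots> \<le> (\<integral>\<alpha>. (1 - indicator D \<alpha>) + e / 3 \<partial>\<mu>)"
  proof (rule integral_mono_AE)
    show "AE \<alpha> in \<mu>. \<alpha> a \<le> (1 - indicator D \<alpha>) + e / 3"
      using \<mu>.AE_S unfolding \<mu>.S_eq_K
    proof eventually_elim
      case (elim \<alpha>)
      then have "h \<alpha> \<le> 1 - indicator D \<alpha>" using h(2,3) by (auto simp: indicator_def)
      then show ?case using a[OF elim] by linarith
    qed
  qed (use Dsets \<mu>.integrable_eval in \<open>auto simp: \<mu>.emeasure_eq_measure\<close>)
  also have "\<dots> = (1 - measure \<mu> D) + e / 3"
    using Dsets by (simp add: \<mu>.emeasure_eq_measure \<mu>.measure_space_1)
  finally show "measure \<nu> C \<le> measure \<mu> C + e" using D3 by simp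
qed

text \<open>\<open>measure_compact_le\<close> applies in both directions, so the measures agree on
  compact sets, and by inner regularity everywhere.\<close>

lemma unique:
  assumes "representation L \<mu>" shows "\<nu> = \<mu>"
proof (rule measure_eqI)
  interpret \<mu>: representation L \<mu> by fact
  have own: "representation L \<nu>" by unfold_locales
  show "sets \<nu> = sets \<mu>" by (simp only: sets_\<nu> \<mu>.sets_\<nu>)
  fix B assume B: "B \<in> sets \<nu>"
  have "emeasure \<nu> C = emeasure \<mu> C" if "compactin character_topology C" for C
    using that measure_compact_le[OF assms, of C] \<mu>.measure_compact_le[OF own, of C]
    by (simp add: compactin_character_topology emeasure_eq_measure \<mu>.emeasure_eq_measure)
  then show "emeasure \<nu> B = emeasure \<mu> B"
    using B \<open>sets \<nu> = sets \<mu>\<close> by (simp add: inner_regular \<mu>.inner_regular)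
qed

end

section \<open>Equivalence of the four conditions, and the resulting identities\<close>

theorem corollary3p1:
  fixes L :: "'a::{real_algebra_1, comm_ring_1} \<Rightarrow> real"
  assumes "(character_space :: ('a \<Rightarrow> real) set) \<noteq> {}"
    and "linear L"
    and "L 1 = 1"
    and "positive_on L sums_of_squares"
  shows
    "((\<exists>!\<nu>. representing_radon_measure L \<nu> \<and>
            compactin character_topology (measure_support character_topology \<nu>))
        \<longleftrightarrow> (\<forall>a. moment_growth L a < \<infinity>)) \<and>
     ((\<forall>a. moment_growth L a < \<infinity>)
        \<longleftrightarrow> (\<exists>p. submultiplicative_seminorm p \<and> seminorm_continuous p L)) \<and>
     ((\<forall>a. moment_growth L a < \<infinity>)
        \<longleftrightarrow> (\<exists>Q. archimedean_quadratic_module Q \<and> positive_on L Q)) \<and>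
     ((\<forall>a. moment_growth L a < \<infinity>) \<longrightarrow>
        (submultiplicative_seminorm (moment_seminorm L) \<and>
         seminorm_continuous (moment_seminorm L) L \<and>
         (\<forall>p. submultiplicative_seminorm p \<and> seminorm_continuous p L
            \<longrightarrow> moment_seminorm L \<le> p)) \<and>
        (archimedean_quadratic_module (moment_quadratic_module L) \<and>
         moment_quadratic_module L =
           quadratic_module hull
             (range (\<lambda>a. moment_seminorm L a *\<^sub>R 1 + a) \<union>
              range (\<lambda>a. moment_seminorm L a *\<^sub>R 1 - a)) \<and>
         positive_on L (moment_quadratic_module L) \<and>
         (\<forall>Q. archimedean_quadratic_module Q \<and> positive_on L Q
            \<longrightarrow> Q \<subseteq> moment_quadratic_module L)) \<and>
        (\<forall>\<nu>. representing_radon_measure L \<nu> \<and>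
              compactin character_topology (measure_support character_topology \<nu>) \<longrightarrow>
           moment_seminorm L = max_seminorm (measure_support character_topology \<nu>) \<and>
           moment_quadratic_module L = Pos (measure_support character_topology \<nu>) \<and>
           measure_support character_topology \<nu> = moment_characters L \<and>
           moment_characters L = gelfand_spectrum (moment_seminorm L) \<and>
           gelfand_spectrum (moment_seminorm L) =
             nonneg_characters (moment_quadratic_module L)))"
    (is "(?i \<longleftrightarrow> ?ii) \<and> (?ii \<longleftrightarrow> ?iii) \<and> (?ii \<longleftrightarrow> ?iv) \<and> (?ii \<longrightarrow> ?P \<and> ?Q \<and> ?S)")
proof -
  interpret algebra_state L
  proof (rule algebra_state.intro)
    show "0 \<le> L (a\<^sup>2)" for a
      using assms(4) quadratic_module_square[OF quadratic_module_sums_of_squares]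
      unfolding positive_on_def by blast
  qed (fact assms)+
  have rep: "representation L \<nu>"
    if "representing_radon_measure L \<nu> \<and> compactin character_topology (measure_support character_topology \<nu>)" for \<nu>
    using that by unfold_locales auto
  have bdd: "bounded_state L" if ?ii
    using that by unfold_locales auto
  have i: ?ii if ?i
    using that rep representation.bounded_growth by blast
  have iii: ?ii if ?iii
    using that
  proof (elim exE conjE, intro allI)
    fix q a assume "submultiplicative_seminorm q" "seminorm_continuous q L"
    from moment_growth_le_of_submultiplicative[OF this, of a] show "moment_growth L a < \<infinity>"
      by (auto intro: le_less_trans)
  qed
  have iv: ?ii if ?iv
    using that moment_growth_finite_of_archimedean by blast
  \<comment> \<open>Condition (ii) is the hub: each of the others implies it, and it implies all of
    them along with the further claims.\<close>
  have ii: "?i \<and> ?iii \<and> ?iv \<and> (?P \<and> ?Q \<and> ?S)" if ?ii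
  proof -
    interpret bounded_state L by (rule bdd[OF that])
    have 1: ?i
      using representing_representing_measure compact_support_representing_measure rep representation.unique
      by (intro ex1I[of _ representing_measure]) blast+
    have 2: ?P
      using submultiplicative_p continuous_p p_le_seminorm by (auto simp: le_fun_def)
    have 3: ?Q
    proof (intro conjI allI impI)
      show "R \<subseteq> Q" if "archimedean_quadratic_module R \<and> positive_on L R" for R
        using that positive_on_imp_subset by (simp add: archimedean_quadratic_module_def)
    qed (fact archimedean_Q Q_eq_H positive_on_moment)+
    have 4: ?S
    proof (intro allI impI)
      fix \<nu>
      assume "representing_radon_measure L \<nu> \<and> compactin character_topology (measure_support character_topology \<nu>)"
      then interpret representation L \<nu> by (rule rep)
      show "moment_seminorm L = max_seminorm S \<and> moment_quadratic_module L = Pos S \<and>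
           S = moment_characters L \<and> moment_characters L = gelfand_spectrum p \<and> gelfand_spectrum p = K"
      proof (intro conjI)
        show "p = max_seminorm S" by (rule max_seminorm_eq_p[symmetric])
        show "Q = Pos S" unfolding S_eq_K by (rule Q_eq_Pos_K)
      qed (simp_all only: S_eq_K moment_characters_eq_K gelfand_spectrum_eq_K)
    qed
    have ?iii ?iv
      using submultiplicative_p continuous_p archimedean_Q positive_on_moment by blast+
    then show ?thesis by (intro conjI 1 2 3 4)
  qed
  show ?thesis
    by (rule conjI[OF iffI[OF i ii[THEN conjunct1]]
        conjI[OF iffI[OF ii[THEN conjunct2, THEN conjunct1] iii]
          conjI[OF iffI[OF ii[THEN conjunct2, THEN conjunct2, THEN conjunct1] iv]
            impI[OF ii[THEN conjunct2, THEN conjunct2, THEN conjunct2]]]]])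
qed

end
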